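(* Let $n,k,l$ be integers with $1\le l<k\le n/2$, and suppose that $$2k\left\lfloor\frac{k-1}{2}\right\rfloor+k-l<n.$$ If the quotient of $q$-binomial coefficients $$\frac{\binom{n}{k}_q}{\binom{n}{l}_q}$$ is a polynomial in $q$, then it has non-negative integer coefficients. In particular, this implication (polynomial implies non-negative coefficients) holds whenever $1\le l<k\le n/2$ and $n\ge k^2$. Hence, for each $k$, the implication holds for all pairs $(l,n)$ with $1\le l<k\le n/2$ except perhaps for finitely many.
   Context: The $q$-binomial coefficient is $$\binom{n}{k}_q=\frac{\prod_{i=1}^n(1-q^i)}{\prod_{i=1}^k(1-q^i)\prod_{i=1}^{n-k}(1-q^i)}.$$ Thus, for $1\le l<k\le n/2$, $$\frac{\binom{n}{k}_q}{\binom{n}{l}_q}=\frac{\prod_{i=1}^l(1-q^i)\prod_{i=1}^{n-l}(1-q^i)}{\prod_{i=1}^k(1-q^i)\prod_{i=1}^{n-k}(1-q^i)}=\frac{\prod_{i=n-k+1}^{n-l}(1-q^i)}{\prod_{i=l+1}^{k}(1-q^i)}.$$ *)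

theory Defs
  imports Complex_Main "HOL-Computational_Algebra.Computational_Algebra"
begin

text \<open>
  The q-binomial coefficients are elements of the field of rational functions in one
  indeterminate over a field of characteristic zero, that is, of the fraction field of
  the polynomial ring.
\<close>

definition qvar :: "'a::field_char_0 poly fract" where
  "qvar = to_fract [:0, 1:]"

text \<open>Only meaningful for \<open>k \<le> n\<close>, because \<open>n - k\<close> is truncated.\<close>

definition qbinom :: "nat \<Rightarrow> nat \<Rightarrow> 'a::field_char_0 poly fract" where
  "qbinom n k =
     (\<Prod>i=1..n. 1 - qvar ^ i) / ((\<Prod>i=1..k. 1 - qvar ^ i) * (\<Prod>i=1..n - k. 1 - qvar ^ i))"

text \<open>
  If a rational function is a polynomial, then its coefficients are non-negative integers.
  The polynomial \<open>p\<close> is unique when it exists, since \<open>to_fract\<close> is injective; \<open>\<nat>\<close> is the set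
  of the images of the natural numbers in the coefficient field.
\<close>

definition nonneg_if_polynomial :: "'a::field_char_0 poly fract \<Rightarrow> bool" where
  "nonneg_if_polynomial f \<longleftrightarrow> (\<forall>p. f = to_fract p \<longrightarrow> (\<forall>i. coeff p i \<in> \<nat>))"

end

theory Submission
  imports Defs "HOL-Library.Poly_Mapping" "HOL-Library.Z2" "HOL-Number_Theory.Cong"
begin

text \<open>
  After cancellation the quotient is \<open>\<Prod>i<m. (1 - q^(a i))\<close> over \<open>\<Prod>j<m. (1 - q^(b j))\<close> with
  \<open>m = k - l\<close>, \<open>a i = n - k + 1 + i\<close> and \<open>b j = l + 1 + j\<close>. A product of this shape is the Hilbert
  series of a graded complete intersection: give the variable \<open>x j\<close> the degree \<open>b j\<close> and let
  \<open>\<theta> i\<close> be a form of degree \<open>a i\<close>. If the \<open>\<theta> i\<close> form a regular sequence, factoring out each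
  of them multiplies the Hilbert series by \<open>1 - q^(a i)\<close>, and so the coefficients of the quotient are
  dimensions.

  Generic forms are a regular sequence exactly when a condition in the style of Hall holds. On the
  coordinate subspace of the variables \<open>x j\<close>, \<open>j \<in> J\<close>, a form of degree \<open>a i\<close> can only be non-zero
  if \<open>a i\<close> lies in the additive semigroup generated by the \<open>b j\<close>, \<open>j \<in> J\<close>, and for each \<open>J\<close> there must be at
  least \<open>card J\<close> such indices \<open>i\<close>. The theorem \<open>hall_imp_nonneg\<close> says that this condition makes all
  coefficients non-negative.

  The condition holds in the case at hand. Comparing multiplicities of a primitive \<open>d\<close>-th root of
  unity (\<open>card_multiples_le\<close>) shows that a polynomial quotient has at least as many \<open>a i\<close> as \<open>b j\<close>
  divisible by \<open>d\<close>. Take for \<open>d\<close> the greatest common divisor of the \<open>b j\<close>, \<open>j \<in> J\<close>. The assumption on \<open>n\<close>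
  puts every \<open>a i\<close> beyond Schur's bound for the Frobenius number (\<open>semigroup_membership\<close>), so that each
  \<open>a i\<close> divisible by \<open>d\<close> lies in the semigroup; for a single \<open>b j\<close> this is true of all multiples anyway.

  For \<open>hall_imp_nonneg\<close> the forms are made generic by taking new variables as their coefficients,
  in a polynomial ring with infinitely many variables. By an argument of McCoy, a generic
  combination of a set \<open>G\<close> is a zero divisor modulo an ideal \<open>Q\<close> only if all of \<open>G\<close> kills a single
  non-zero class (\<open>generic_zero_divisor\<close>). This gives an elementary theory of depth, which is
  independent of the chosen regular elements (\<open>depth_ge_adjoin\<close>), bounded below in an extension by the
  depths of its two ends (\<open>depth_ge_extension\<close>) and preserved by a generic element of a second set,
  provided that the two sets together have greater depth (\<open>depth_ge_adjoin_generic\<close>). Hall's condition is a lower bound for the depths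
  of the monomial ideals that occur (\<open>depth_ge_monomials\<close>).

  The coefficient variables carry a second degree \<open>s\<close>. Dividing the bigraded Hilbert function by the
  number of monomials of degree \<open>s\<close> in them and letting \<open>s\<close> tend to infinity removes them again.
\<close>

section \<open>Ideals and regular elements\<close>

definition is_ideal :: "'r::comm_ring_1 set \<Rightarrow> bool" where
  "is_ideal Q \<longleftrightarrow> 0 \<in> Q \<and> (\<forall>x\<in>Q. \<forall>y\<in>Q. x + y \<in> Q) \<and> (\<forall>r. \<forall>x\<in>Q. r * x \<in> Q)"

definition ideal_span :: "'r::comm_ring_1 set \<Rightarrow> 'r set" where
  "ideal_span G = \<Inter>{Q. is_ideal Q \<and> G \<subseteq> Q}"

definition adjoin :: "'r::comm_ring_1 set \<Rightarrow> 'r \<Rightarrow> 'r set" where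
  "adjoin Q \<theta> = {q + r * \<theta> | q r. q \<in> Q}"

text \<open>
  "Regular" and "faithful" are properties of the module \<open>S/Q\<close>, which is represented by the ideal
  \<open>Q\<close> throughout: \<open>\<theta>\<close> is a non-zero-divisor on it, or no non-zero element of it is killed by all of \<open>G\<close>.
  The ideal \<open>Q\<close> may be the whole ring, in which case both hold trivially.
\<close>

definition regular :: "'r::comm_ring_1 set \<Rightarrow> 'r \<Rightarrow> bool" where
  "regular Q \<theta> \<longleftrightarrow> (\<forall>z. \<theta> * z \<in> Q \<longrightarrow> z \<in> Q)"

definition faithful :: "'r::comm_ring_1 set \<Rightarrow> 'r set \<Rightarrow> bool" where
  "faithful Q G \<longleftrightarrow> (\<forall>z. (\<forall>g\<in>G. g * z \<in> Q) \<longrightarrow> z \<in> Q)"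

lemma is_idealD:
  assumes "is_ideal Q"
  shows is_ideal_zero: "0 \<in> Q"
    and is_ideal_add: "x \<in> Q \<Longrightarrow> y \<in> Q \<Longrightarrow> x + y \<in> Q"
    and is_ideal_mult: "x \<in> Q \<Longrightarrow> r * x \<in> Q"
    and is_ideal_mult': "x \<in> Q \<Longrightarrow> x * r \<in> Q"
    and is_ideal_diff: "x \<in> Q \<Longrightarrow> y \<in> Q \<Longrightarrow> x - y \<in> Q"
proof -
  show "0 \<in> Q" "x \<in> Q \<Longrightarrow> y \<in> Q \<Longrightarrow> x + y \<in> Q" "x \<in> Q \<Longrightarrow> r * x \<in> Q" for x y r
    using assms by (auto simp: is_ideal_def)
  from this(2)[of x "-1 * y"] this(3)[of x r] this(3)[of y "-1"]
  show "x \<in> Q \<Longrightarrow> x * r \<in> Q" "x \<in> Q \<Longrightarrow> y \<in> Q \<Longrightarrow> x - y \<in> Q"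
    by (simp_all add: mult.commute)
qed

lemma is_ideal_sum:
  assumes "is_ideal Q" "\<And>i. i \<in> I \<Longrightarrow> f i \<in> Q"
  shows "sum f I \<in> Q"
  using assms(2) by (induction I rule: infinite_finite_induct) (simp_all add: is_ideal_zero[OF assms(1)] is_ideal_add[OF assms(1)])

lemma is_ideal_zero_set [simp]: "is_ideal {0}"
  by (simp add: is_ideal_def)

lemma is_ideal_span [simp]: "is_ideal (ideal_span G)"
  by (auto simp: ideal_span_def is_ideal_def)

lemma ideal_span_superset: "G \<subseteq> ideal_span G"
  by (auto simp: ideal_span_def)

lemma ideal_span_least: "is_ideal Q \<Longrightarrow> G \<subseteq> Q \<Longrightarrow> ideal_span G \<subseteq> Q"
  by (auto simp: ideal_span_def)

lemma ideal_span_mono: "G \<subseteq> H \<Longrightarrow> ideal_span G \<subseteq> ideal_span H"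
  by (auto simp: ideal_span_def)

lemma adjoin_iff: "x \<in> adjoin Q \<theta> \<longleftrightarrow> (\<exists>r. x - r * \<theta> \<in> Q)"
proof
  assume "x \<in> adjoin Q \<theta>"
  then obtain q r where "q \<in> Q" "x = q + r * \<theta>" by (auto simp: adjoin_def)
  then have "x - r * \<theta> \<in> Q" by simp
  then show "\<exists>r. x - r * \<theta> \<in> Q" ..
next
  assume "\<exists>r. x - r * \<theta> \<in> Q"
  then obtain r where "x - r * \<theta> \<in> Q" ..
  moreover have "x = (x - r * \<theta>) + r * \<theta>" by simp
  ultimately show "x \<in> adjoin Q \<theta>" unfolding adjoin_def by blast
qed

lemma adjoinE:
  assumes "x \<in> adjoin Q \<theta>"
  obtains q r where "q \<in> Q" "x = q + r * \<theta>"
  using assms by (auto simp: adjoin_def)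

lemma is_ideal_adjoin [simp]:
  assumes "is_ideal Q"
  shows "is_ideal (adjoin Q \<theta>)"
proof -
  note D = is_idealD[OF assms]
  have "x + y \<in> adjoin Q \<theta>" if "x \<in> adjoin Q \<theta>" "y \<in> adjoin Q \<theta>" for x y
  proof -
    from that obtain r s where "x - r * \<theta> \<in> Q" "y - s * \<theta> \<in> Q" by (auto simp: adjoin_iff)
    from D(2)[OF this] have "(x + y) - (r + s) * \<theta> \<in> Q" by (simp add: algebra_simps)
    then show ?thesis unfolding adjoin_iff by blast
  qed
  moreover have "s * x \<in> adjoin Q \<theta>" if "x \<in> adjoin Q \<theta>" for x s
  proof -
    from that obtain r where "x - r * \<theta> \<in> Q" by (auto simp: adjoin_iff)
    from D(3)[OF this, of s] have "s * x - (s * r) * \<theta> \<in> Q" by (simp add: algebra_simps)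
    then show ?thesis unfolding adjoin_iff by blast
  qed
  moreover have "0 \<in> adjoin Q \<theta>"
    unfolding adjoin_iff by (rule exI[of _ 0]) (simp add: D)
  ultimately show ?thesis by (simp add: is_ideal_def)
qed

lemma adjoin_superset: "Q \<subseteq> adjoin Q \<theta>"
proof
  fix x assume "x \<in> Q"
  then have "x - 0 * \<theta> \<in> Q" by simp
  then show "x \<in> adjoin Q \<theta>" unfolding adjoin_iff ..
qed

lemma adjoin_mem: "is_ideal Q \<Longrightarrow> r * \<theta> \<in> adjoin Q \<theta>"
  unfolding adjoin_iff by (rule exI[of _ r]) (simp add: is_ideal_zero)

lemma adjoin_self: "is_ideal Q \<Longrightarrow> \<theta> \<in> adjoin Q \<theta>"
  using adjoin_mem[of Q 1 \<theta>] by simp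

lemma adjoin_commute: "adjoin (adjoin Q a) b = adjoin (adjoin Q b) a"
proof -
  have "x - r * a - s * b = x - s * b - r * a" for x r s :: 'a by simp
  then show ?thesis unfolding set_eq_iff adjoin_iff by (simp only:) blast
qed

lemma adjoin_one: "is_ideal Q \<Longrightarrow> adjoin Q 1 = UNIV"
  using adjoin_mem[of Q _ 1] by auto

lemma regularD: "regular Q \<theta> \<Longrightarrow> \<theta> * z \<in> Q \<Longrightarrow> z \<in> Q"
  by (auto simp: regular_def)

lemma regular_mult: "regular Q a \<Longrightarrow> regular Q b \<Longrightarrow> regular Q (a * b)"
  unfolding regular_def mult.assoc by blast

lemma regular_one: "regular Q 1"
  by (auto simp: regular_def)

lemma faithfulD: "faithful Q G \<Longrightarrow> (\<And>g. g \<in> G \<Longrightarrow> g * z \<in> Q) \<Longrightarrow> z \<in> Q"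
  by (auto simp: faithful_def)

lemma is_ideal_colon [simp]: "is_ideal Q \<Longrightarrow> is_ideal {r. r * z \<in> Q}"
  by (simp add: is_ideal_def ring_distribs mult.assoc)

lemma faithful_if_regular:
  assumes "is_ideal Q" "\<theta> \<in> ideal_span G" "regular Q \<theta>"
  shows "faithful Q G"
  unfolding faithful_def
proof (intro allI impI)
  fix z assume z: "\<forall>g\<in>G. g * z \<in> Q"
  have "ideal_span G \<subseteq> {r. r * z \<in> Q}"
    using z assms(1) by (intro ideal_span_least) auto
  then show "z \<in> Q" using assms(2,3) by (auto simp: regular_def)
qed

text \<open>
  This half of the permutability of regular sequences holds for every module, without a grading or a local
  ring.
\<close>

lemma regular_exchange:
  assumes Q: "is_ideal Q" and a: "regular Q a" and b: "regular (adjoin Q a) b"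
  shows "regular (adjoin Q b) a"
  unfolding regular_def
proof (intro allI impI)
  fix x assume "a * x \<in> adjoin Q b"
  then obtain y where y: "a * x - y * b \<in> Q" by (auto simp: adjoin_iff)
  then have "b * y - x * a \<in> Q"
    using is_ideal_mult[OF Q y, of "-1"] by (simp add: algebra_simps)
  then have "b * y \<in> adjoin Q a" by (auto simp: adjoin_iff)
  then have "y \<in> adjoin Q a" using b by (rule regularD[rotated])
  then obtain z where z: "y - z * a \<in> Q" by (auto simp: adjoin_iff)
  have "a * (x - z * b) = (a * x - y * b) + b * (y - z * a)" by (simp add: algebra_simps)
  also have "\<dots> \<in> Q" by (rule is_ideal_add[OF Q y is_ideal_mult[OF Q z]])
  finally have "x - z * b \<in> Q" using a by (rule regularD[rotated])
  then show "x \<in> adjoin Q b" by (auto simp: adjoin_iff)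
qed

text \<open>
  The submodule of \<open>S/(Q, \<theta>)\<close> that \<open>G\<close> kills embeds into the one of \<open>S/(Q, \<psi>)\<close>: if \<open>z\<close> is killed by \<open>G\<close> modulo
  \<open>\<theta>\<close>, then \<open>\<psi> z = w \<theta>\<close> modulo \<open>Q\<close> for some \<open>w\<close>, which is killed by \<open>G\<close> modulo \<open>\<psi>\<close>. (If \<open>\<theta>\<close>, too, is in
  the span of \<open>G\<close>, both submodules are the same Ext module of \<open>S/Q\<close>.) Since \<open>w\<close> is also killed by \<open>\<theta>\<close> modulo \<open>\<psi>\<close>, faithfulness is only demanded of
  \<open>G\<close> together with \<open>\<theta>\<close>.
\<close>

lemma faithful_swap:
  assumes Q: "is_ideal Q" and th: "regular Q \<theta>" and ps: "regular Q \<psi>"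
    and G: "\<psi> \<in> ideal_span G"
    and f: "\<And>w. (\<And>g. g \<in> G \<Longrightarrow> g * w \<in> adjoin Q \<psi>) \<Longrightarrow> \<theta> * w \<in> adjoin Q \<psi> \<Longrightarrow> w \<in> adjoin Q \<psi>"
  shows "faithful (adjoin Q \<theta>) G"
  unfolding faithful_def
proof (intro allI impI)
  note D = is_idealD[OF Q]
  fix z assume z: "\<forall>g\<in>G. g * z \<in> adjoin Q \<theta>"
  have "ideal_span G \<subseteq> {r. r * z \<in> adjoin Q \<theta>}"
    using z Q by (intro ideal_span_least) auto
  then have "\<psi> * z \<in> adjoin Q \<theta>" using G by auto
  then obtain w where w: "\<psi> * z - w * \<theta> \<in> Q" by (auto simp: adjoin_iff)
  have "w \<in> adjoin Q \<psi>"
  proof (rule f)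
    fix g assume "g \<in> G"
    then have "g * z \<in> adjoin Q \<theta>" using z by auto
    then obtain y where y: "g * z - y * \<theta> \<in> Q" by (auto simp: adjoin_iff)
    have "\<theta> * (g * w - y * \<psi>) = \<psi> * (g * z - y * \<theta>) - g * (\<psi> * z - w * \<theta>)"
      by (simp add: algebra_simps)
    also have "\<dots> \<in> Q" by (rule D(5)[OF D(3)[OF y] D(3)[OF w]])
    finally have "g * w - y * \<psi> \<in> Q" using th by (rule regularD[rotated])
    then show "g * w \<in> adjoin Q \<psi>" by (auto simp: adjoin_iff)
  next
    have "\<theta> * w - z * \<psi> = (-1) * (\<psi> * z - w * \<theta>)" by (simp add: algebra_simps)
    also have "\<dots> \<in> Q" using w by (rule D(3))
    finally show "\<theta> * w \<in> adjoin Q \<psi>" by (auto simp: adjoin_iff)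
  qed
  then obtain y where y: "w - y * \<psi> \<in> Q" by (auto simp: adjoin_iff)
  have "\<psi> * (z - y * \<theta>) = (\<psi> * z - w * \<theta>) + \<theta> * (w - y * \<psi>)" by (simp add: algebra_simps)
  also have "\<dots> \<in> Q" by (rule D(2)[OF w D(3)[OF y]])
  finally have "z - y * \<theta> \<in> Q" using ps by (rule regularD[rotated])
  then show "z \<in> adjoin Q \<theta>" by (auto simp: adjoin_iff)
qed

section \<open>Polynomials in infinitely many variables\<close>

text \<open>
  The variable \<open>(0, j)\<close> plays the role of \<open>x j\<close>; for \<open>n > 0\<close> the variables \<open>(n, j)\<close> form the \<open>n\<close>-th block of
  coefficients of generic elements. Over the field with two elements the graded pieces are finite sets, and
  dimensions can be replaced by cardinalities.
\<close>

type_synonym gpoly = "((nat \<times> nat) \<Rightarrow>\<^sub>0 nat) \<Rightarrow>\<^sub>0 bit"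

definition var :: "nat \<times> nat \<Rightarrow> gpoly" where
  "var v = Poly_Mapping.single (Poly_Mapping.single v 1) 1"

text \<open>
  Division by the variable \<open>v\<close>, discarding the monomials without \<open>v\<close>. All that is needed about "not
  involving \<open>v\<close>" can be said with this operator: an element does not involve \<open>v\<close> if multiplication by it
  commutes with \<open>strip v\<close>, and an ideal generated by such elements is closed under \<open>strip v\<close>.
\<close>

definition strip :: "nat \<times> nat \<Rightarrow> gpoly \<Rightarrow> gpoly" where
  "strip v p = Poly_Mapping.map_key (\<lambda>\<mu>. Poly_Mapping.single v 1 + \<mu>) p"

definition free_of :: "nat \<times> nat \<Rightarrow> gpoly \<Rightarrow> bool" where
  "free_of v g \<longleftrightarrow> (\<forall>p. strip v (g * p) = g * strip v p)"

definition strip_closed :: "nat \<times> nat \<Rightarrow> gpoly set \<Rightarrow> bool" where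
  "strip_closed v Q \<longleftrightarrow> (\<forall>p\<in>Q. strip v p \<in> Q)"

lemma lookup_strip: "Poly_Mapping.lookup (strip v p) \<mu> = Poly_Mapping.lookup p (Poly_Mapping.single v 1 + \<mu>)"
  by (simp add: strip_def map_key.rep_eq inj_on_def)

lemma strip_add: "strip v (p + q) = strip v p + strip v q"
  by (rule poly_mapping_eqI) (simp add: lookup_strip lookup_add)

lemma strip_zero: "strip v 0 = 0"
  by (rule poly_mapping_eqI) (simp add: lookup_strip)

lemma lookup_var_mult:
  fixes \<mu> :: "nat \<times> nat \<Rightarrow>\<^sub>0 nat" and p :: gpoly
  shows "Poly_Mapping.lookup (var v * p) \<mu> =
     (if Poly_Mapping.lookup \<mu> v = 0 then 0 else Poly_Mapping.lookup p (\<mu> - Poly_Mapping.single v 1))"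
proof -
  have "Poly_Mapping.lookup (var v * p) \<mu> = (\<Sum>q. Poly_Mapping.lookup p q when \<mu> = Poly_Mapping.single v 1 + q)"
    by (simp only: lookup_mult var_def lookup_single when_mult mult_1 Sum_any_when_equal')
  also have "\<dots> = (if Poly_Mapping.lookup \<mu> v = 0 then 0 else Poly_Mapping.lookup p (\<mu> - Poly_Mapping.single v 1))"
  proof (cases "Poly_Mapping.lookup \<mu> v = 0")
    case True
    then have "\<mu> \<noteq> Poly_Mapping.single v 1 + q" for q
      by (auto simp: lookup_add)
    then show ?thesis using True by simp
  next
    case False
    have "Poly_Mapping.single v 1 + (\<mu> - Poly_Mapping.single v 1) = \<mu>"
      using False by (intro poly_mapping_eqI) (auto simp: lookup_add lookup_minus lookup_single when_def)
    then have "\<mu> = Poly_Mapping.single v 1 + q \<longleftrightarrow> \<mu> - Poly_Mapping.single v 1 = q" for q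
      by (metis add_diff_cancel_left')
    then show ?thesis using False by simp
  qed
  finally show ?thesis .
qed

lemma strip_var_mult: "strip v (var v * p) = p"
  by (rule poly_mapping_eqI) (simp add: lookup_strip lookup_var_mult lookup_add)

lemma free_of_var:
  assumes "w \<noteq> v"
  shows "free_of v (var w)"
  unfolding free_of_def
proof (intro allI poly_mapping_eqI)
  fix p \<mu>
  have "Poly_Mapping.single v 1 + \<mu> - Poly_Mapping.single w 1
      = Poly_Mapping.single v 1 + (\<mu> - Poly_Mapping.single w (1::nat))" if "Poly_Mapping.lookup \<mu> w \<noteq> 0"
    using that assms
    by (auto simp: poly_mapping_eq_iff fun_eq_iff lookup_add lookup_minus lookup_single when_def)
  then show "Poly_Mapping.lookup (strip v (var w * p)) \<mu> = Poly_Mapping.lookup (var w * strip v p) \<mu>"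
    using assms by (simp add: lookup_strip lookup_var_mult lookup_add lookup_single)
qed

lemma free_of_mult: "free_of v g \<Longrightarrow> free_of v h \<Longrightarrow> free_of v (g * h)"
  by (simp add: free_of_def mult.assoc)

lemma free_of_add: "free_of v g \<Longrightarrow> free_of v h \<Longrightarrow> free_of v (g + h)"
  by (simp add: free_of_def ring_distribs strip_add)

lemma free_of_zero: "free_of v 0"
  by (simp add: free_of_def strip_zero)

lemma free_of_one: "free_of v 1"
  by (simp add: free_of_def)

lemma free_of_sum: "(\<And>i. i \<in> I \<Longrightarrow> free_of v (f i)) \<Longrightarrow> free_of v (sum f I)"
  by (induction I rule: infinite_finite_induct) (auto intro: free_of_zero free_of_add)

lemma free_of_prod: "(\<And>i. i \<in> I \<Longrightarrow> free_of v (f i)) \<Longrightarrow> free_of v (prod f I)"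
  by (induction I rule: infinite_finite_induct) (auto intro: free_of_one free_of_mult)

lemma free_of_power: "free_of v g \<Longrightarrow> free_of v (g ^ e)"
  by (induction e) (auto intro: free_of_one free_of_mult)

lemma strip_pow_vanishes: "\<exists>k. (strip v ^^ k) p = 0"
proof -
  have lk: "Poly_Mapping.lookup ((strip v ^^ k) p) \<mu> = Poly_Mapping.lookup p (Poly_Mapping.single v k + \<mu>)" for k \<mu>
  proof (induction k arbitrary: \<mu>)
    case (Suc k)
    have "Poly_Mapping.single v k + (Poly_Mapping.single v 1 + \<mu>)
        = Poly_Mapping.single v (Suc k) + \<mu>"
      by (simp add: add.assoc[symmetric] single_add[symmetric])
    then show ?case by (simp add: Suc lookup_strip)
  qed simp
  obtain k where k: "\<forall>\<mu>\<in>Poly_Mapping.keys p. Poly_Mapping.lookup \<mu> v < k"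
    using finite_nat_set_iff_bounded[of "(\<lambda>\<mu>. Poly_Mapping.lookup \<mu> v) ` Poly_Mapping.keys p"] by auto
  have "Poly_Mapping.lookup p (Poly_Mapping.single v k + \<mu>) = 0" for \<mu>
    using k by (force simp: lookup_add in_keys_iff)
  then have "(strip v ^^ k) p = 0"
    by (intro poly_mapping_eqI) (simp add: lk)
  then show ?thesis ..
qed

text \<open>
  Let \<open>k\<close> be minimal such that \<open>strip v ^^ k\<close> moves \<open>w\<close> into \<open>Q\<close>; informally, \<open>k\<close> exceeds the degree in \<open>v\<close>
  of the class of \<open>w\<close> by one. The leading coefficient of \<open>(v g + h) w\<close> shows that \<open>g\<close> kills the leading coefficient
  of \<open>w\<close>, so that \<open>k\<close> decreases when \<open>w\<close> is replaced by \<open>g w\<close>. After finitely many steps \<open>g\<close> kills the class of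
  \<open>g ^ e * w\<close> while this class is still non-zero.
\<close>

lemma zero_divisor_step:
  assumes Q: "is_ideal Q" and st: "strip_closed v Q"
    and g: "free_of v g" and h: "free_of v h"
    and "(var v * g + h) * w \<in> Q" "w \<notin> Q"
  shows "\<exists>e. g ^ e * w \<notin> Q \<and> g ^ Suc e * w \<in> Q"
proof -
  note D = is_idealD[OF Q]
  have pow: "(strip v ^^ k) p \<in> Q" if "p \<in> Q" for p k
    using that st by (induction k) (auto simp: strip_closed_def)
  have free_pow: "(strip v ^^ k) (f * p) = f * (strip v ^^ k) p" if "free_of v f" for f p k
    using that by (induction k) (auto simp: free_of_def)
  have add_pow: "(strip v ^^ k) (p + q) = (strip v ^^ k) p + (strip v ^^ k) q" for p q k
    by (induction k) (auto simp: strip_add)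
  have "\<exists>e. g ^ e * w \<notin> Q \<and> g ^ Suc e * w \<in> Q"
    if "(strip v ^^ k) w \<in> Q" "(var v * g + h) * w \<in> Q" "w \<notin> Q" for k
    using that
  proof (induction k arbitrary: w)
    case 0
    then show ?case by simp
  next
    case (Suc k)
    have "(strip v ^^ Suc k) ((var v * g + h) * w)
        = (strip v ^^ k) (strip v (var v * (g * w))) + (strip v ^^ Suc k) (h * w)"
      by (simp add: ring_distribs add_pow strip_add mult.assoc funpow_swap1)
    also have "\<dots> = g * (strip v ^^ k) w + h * (strip v ^^ Suc k) w"
      by (simp only: strip_var_mult free_pow[OF g] free_pow[OF h])
    finally have "g * (strip v ^^ k) w + h * (strip v ^^ Suc k) w \<in> Q"
      using pow[OF Suc.prems(2), of "Suc k"] by simp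
    from D(5)[OF this D(3)[OF Suc.prems(1), of h]] have *: "(strip v ^^ k) (g * w) \<in> Q"
      by (simp add: free_pow[OF g])
    show ?case
    proof (cases "g * w \<in> Q")
      case True
      then have "g ^ 0 * w \<notin> Q \<and> g ^ Suc 0 * w \<in> Q" using Suc.prems by simp
      then show ?thesis by blast
    next
      case False
      have "(var v * g + h) * (g * w) \<in> Q"
        using D(3)[OF Suc.prems(2), of g] by (simp add: ac_simps)
      from Suc.IH[OF * this False] obtain e
        where "g ^ e * (g * w) \<notin> Q \<and> g ^ Suc e * (g * w) \<in> Q" by blast
      then have "g ^ Suc e * w \<notin> Q \<and> g ^ Suc (Suc e) * w \<in> Q"
        by (simp add: ac_simps)
      then show ?thesis by blast
    qed
  qed
  moreover obtain k where "(strip v ^^ k) w = 0" using strip_pow_vanishes by blast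
  ultimately show ?thesis using assms D(1) by metis
qed

section \<open>Generic linear combinations\<close>

definition generic :: "nat \<Rightarrow> gpoly list \<Rightarrow> gpoly" where
  "generic n gs = (\<Sum>j<length gs. var (n, j) * gs ! j)"

text \<open>
  McCoy's theorem for linear forms: the coefficients \<open>gs ! j\<close> are treated one after the other. Each step passes
  to a multiple of \<open>w\<close>, and whatever killed \<open>w\<close> before still kills the multiple. For this reason the
  result gives a multiple of the original \<open>w\<close> and not just some element.
\<close>

lemma generic_zero_divisor:
  assumes Q: "is_ideal Q" and st: "\<And>j. strip_closed (n, j) Q"
    and gs: "\<And>g j. g \<in> set gs \<Longrightarrow> free_of (n, j) g"
    and w: "generic n gs * w \<in> Q" "w \<notin> Q"
  shows "\<exists>r. r * w \<notin> Q \<and> (\<forall>g\<in>set gs. g * (r * w) \<in> Q)"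
proof -
  note D = is_idealD[OF Q]
  have "\<exists>r. r * w \<notin> Q \<and> (\<forall>i<j. gs ! i * (r * w) \<in> Q)" if "j \<le> length gs" for j
    using that
  proof (induction j)
    case 0
    show ?case using w(2) by (intro exI[of _ 1]) simp
  next
    case (Suc j)
    then obtain r where r: "r * w \<notin> Q" "\<forall>i<j. gs ! i * (r * w) \<in> Q" by auto
    define h where "h = (\<Sum>i\<in>{..<length gs} - {j}. var (n, i) * gs ! i)"
    have split: "generic n gs = var (n, j) * gs ! j + h"
      unfolding generic_def h_def using Suc.prems by (subst sum.remove[of _ j]) auto
    have "free_of (n, j) h"
      unfolding h_def by (intro free_of_sum free_of_mult free_of_var gs) auto
    moreover have "(var (n, j) * gs ! j + h) * (r * w) \<in> Q"
      using D(3)[OF w(1), of r] unfolding split by (simp add: ac_simps)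
    moreover have "free_of (n, j) (gs ! j)" using gs Suc.prems by auto
    ultimately obtain e where e: "(gs ! j) ^ e * (r * w) \<notin> Q" "(gs ! j) ^ Suc e * (r * w) \<in> Q"
      using zero_divisor_step[OF Q st] r(1) by metis
    have "gs ! i * (((gs ! j) ^ e * r) * w) \<in> Q" if "i < Suc j" for i
    proof (cases "i = j")
      case True
      then show ?thesis using e(2) by (simp add: ac_simps)
    next
      case False
      then have "(gs ! j) ^ e * (gs ! i * (r * w)) \<in> Q" using r(2) that by (intro D(3)[of "gs ! i * (r * w)"]) auto
      then show ?thesis by (simp add: ac_simps)
    qed
    with e(1) show ?case by (intro exI[of _ "(gs ! j) ^ e * r"]) (auto simp: ac_simps)
  qed
  from this[of "length gs"] show ?thesis by (metis in_set_conv_nth order_refl)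
qed

lemma generic_regular:
  assumes "is_ideal Q" "\<And>j. strip_closed (n, j) Q"
    and "\<And>g j. g \<in> set gs \<Longrightarrow> free_of (n, j) g"
    and "faithful Q (set gs)"
  shows "regular Q (generic n gs)"
  unfolding regular_def
  using generic_zero_divisor[OF assms(1-3)] faithfulD[OF assms(4)] by blast

lemma generic_in_span: "set gs \<subseteq> G \<Longrightarrow> generic n gs \<in> ideal_span G"
  unfolding generic_def using ideal_span_superset[of G]
  by (intro is_ideal_sum is_ideal_mult) (auto dest: nth_mem)

section \<open>Depth\<close>

text \<open>
  Tame elements and ideals leave almost all blocks of variables untouched, so that fresh blocks for further
  generic elements are always at hand.
\<close>

definition tame :: "gpoly \<Rightarrow> bool" where
  "tame g \<longleftrightarrow> (\<forall>\<^sub>F n in sequentially. \<forall>j. free_of (n, j) g)"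

definition tame_ideal :: "gpoly set \<Rightarrow> bool" where
  "tame_ideal Q \<longleftrightarrow> is_ideal Q \<and> (\<forall>\<^sub>F n in sequentially. \<forall>j. strip_closed (n, j) Q)"

lemma tame_ideal_is_ideal [simp, dest]: "tame_ideal Q \<Longrightarrow> is_ideal Q"
  by (simp add: tame_ideal_def)

lemma strip_closed_adjoin:
  assumes "is_ideal Q" "strip_closed v Q" "free_of v \<theta>"
  shows "strip_closed v (adjoin Q \<theta>)"
  unfolding strip_closed_def
proof
  fix p assume "p \<in> adjoin Q \<theta>"
  then obtain q r where p: "q \<in> Q" "p = q + r * \<theta>" by (rule adjoinE)
  have "strip v (r * \<theta>) = strip v r * \<theta>"
    using assms(3) unfolding free_of_def by (metis mult.commute)
  then have "strip v p = strip v q + strip v r * \<theta>" using p by (simp add: strip_add)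
  moreover have "strip v q \<in> Q" using p assms(2) by (auto simp: strip_closed_def)
  ultimately show "strip v p \<in> adjoin Q \<theta>" unfolding adjoin_def by blast
qed

lemma tame_ideal_adjoin:
  assumes "tame_ideal Q" "tame \<theta>"
  shows "tame_ideal (adjoin Q \<theta>)"
proof -
  have "\<forall>\<^sub>F n in sequentially. (\<forall>j. strip_closed (n, j) Q) \<and> (\<forall>j. free_of (n, j) \<theta>)"
    using assms by (intro eventually_conj) (auto simp: tame_def tame_ideal_def)
  then have "\<forall>\<^sub>F n in sequentially. \<forall>j. strip_closed (n, j) (adjoin Q \<theta>)"
    by eventually_elim (use assms in \<open>auto intro: strip_closed_adjoin\<close>)
  then show ?thesis using assms by (simp add: tame_ideal_def)
qed

lemma tame_mult: "tame g \<Longrightarrow> tame h \<Longrightarrow> tame (g * h)"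
  unfolding tame_def by (drule (1) eventually_conj, erule eventually_mono) (auto intro: free_of_mult)

lemma tame_add: "tame g \<Longrightarrow> tame h \<Longrightarrow> tame (g + h)"
  unfolding tame_def by (drule (1) eventually_conj, erule eventually_mono) (auto intro: free_of_add)

lemma tame_one: "tame 1" and tame_zero: "tame 0"
  by (simp_all add: tame_def free_of_one free_of_zero)

lemma tame_var: "tame (var (m, i))"
  unfolding tame_def using eventually_gt_at_top[of m]
  by (rule eventually_mono) (auto intro: free_of_var)

lemma tame_sum: "(\<And>i. i \<in> I \<Longrightarrow> tame (f i)) \<Longrightarrow> tame (sum f I)"
  by (induction I rule: infinite_finite_induct) (auto intro: tame_zero tame_add)

lemma tame_prod: "(\<And>i. i \<in> I \<Longrightarrow> tame (f i)) \<Longrightarrow> tame (prod f I)"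
  by (induction I rule: infinite_finite_induct) (auto intro: tame_one tame_mult)

lemma tame_power: "tame g \<Longrightarrow> tame (g ^ e)"
  by (induction e) (auto intro: tame_one tame_mult)

lemma tame_generic: "(\<And>g. g \<in> set gs \<Longrightarrow> tame g) \<Longrightarrow> tame (generic n gs)"
  unfolding generic_def by (intro tame_sum tame_mult tame_var) auto

text \<open>
  One generic element of \<open>G\<close> serves finitely many ideals at once. This replaces the prime avoidance of the
  Noetherian theory.
\<close>

lemma fresh_generic:
  assumes G: "finite G" "\<And>g. g \<in> G \<Longrightarrow> tame g" and QQ: "finite QQ" "\<And>Q. Q \<in> QQ \<Longrightarrow> tame_ideal Q"
  obtains \<eta> where "tame \<eta>" "\<eta> \<in> ideal_span G"
    "\<And>Q. Q \<in> QQ \<Longrightarrow> faithful Q G \<Longrightarrow> regular Q \<eta>"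
proof -
  obtain gs where gs: "set gs = G" using finite_list[OF G(1)] by blast
  have "\<forall>\<^sub>F n in sequentially. (\<forall>g\<in>G. \<forall>j. free_of (n, j) g) \<and> (\<forall>Q\<in>QQ. \<forall>j. strip_closed (n, j) Q)"
    using G(2) QQ(2) by (intro eventually_conj eventually_ball_finite G(1) QQ(1) ballI)
      (auto simp: tame_def tame_ideal_def)
  then obtain n where n: "\<forall>g\<in>G. \<forall>j. free_of (n, j) g" "\<forall>Q\<in>QQ. \<forall>j. strip_closed (n, j) Q"
    by (auto simp: eventually_sequentially)
  show thesis
  proof (rule that[of "generic n gs"])
    show "regular Q (generic n gs)" if "Q \<in> QQ" "faithful Q G" for Q
      using that n QQ gs by (intro generic_regular) auto
    show "tame (generic n gs)" using gs G by (intro tame_generic) auto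
  qed (use n gs in \<open>auto intro: generic_in_span\<close>)
qed

text \<open>
  Depth (or grade) of the ideal spanned by \<open>G\<close> on \<open>S/Q\<close>, as the length of some regular sequence in that
  ideal.
\<close>

primrec depth_ge :: "gpoly set \<Rightarrow> nat \<Rightarrow> gpoly set \<Rightarrow> bool" where
  "depth_ge G 0 Q \<longleftrightarrow> True"
| "depth_ge G (Suc r) Q \<longleftrightarrow>
     (\<exists>\<theta>\<in>ideal_span G. tame \<theta> \<and> regular Q \<theta> \<and> depth_ge G r (adjoin Q \<theta>))"

lemma depth_ge_Suc_faithful: "is_ideal Q \<Longrightarrow> depth_ge G (Suc r) Q \<Longrightarrow> faithful Q G"
  by (auto intro: faithful_if_regular)

text \<open>
  Depth drops by at most one modulo any regular element, not only modulo the one provided by the definition.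
  A generic \<open>\<eta>\<close> that is regular modulo both \<open>\<theta>\<close> and the provided \<open>\<psi>\<close> mediates between the two: by induction
  depth passes from \<open>\<psi>\<close> to \<open>\<psi>, \<eta>\<close>, hence to \<open>\<eta>\<close>, then to \<open>\<eta>, \<theta>\<close> and finally to \<open>\<theta>\<close>.
\<close>

lemma depth_ge_adjoin:
  assumes G: "finite G" "\<And>g. g \<in> G \<Longrightarrow> tame g"
  shows "tame_ideal Q \<Longrightarrow> depth_ge G (Suc r) Q \<Longrightarrow> \<theta> \<in> ideal_span G \<Longrightarrow> tame \<theta> \<Longrightarrow> regular Q \<theta>
     \<Longrightarrow> depth_ge G r (adjoin Q \<theta>)"
proof (induction r arbitrary: Q \<theta>)
  case (Suc r)
  note Q = Suc.prems(1) and \<theta> = Suc.prems(3-5)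
  from Suc.prems(2) obtain \<psi> where \<psi>: "\<psi> \<in> ideal_span G" "tame \<psi>" "regular Q \<psi>"
    and d: "depth_ge G (Suc r) (adjoin Q \<psi>)" by auto
  have t: "tame_ideal (adjoin Q \<theta>)" "tame_ideal (adjoin Q \<psi>)"
    using Q \<theta> \<psi> by (auto intro: tame_ideal_adjoin)
  have f\<psi>: "faithful (adjoin Q \<psi>) G"
    using d t by (intro depth_ge_Suc_faithful) auto
  have fQ: "faithful Q G"
    using \<psi> Q by (intro faithful_if_regular) auto
  have f\<theta>: "faithful (adjoin Q \<theta>) G"
    using Q by (intro faithful_swap[OF _ \<theta>(3) \<psi>(3) \<psi>(1)]) (simp, rule faithfulD[OF f\<psi>])
  obtain \<eta> where \<eta>: "tame \<eta>" "\<eta> \<in> ideal_span G"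
    "\<And>Q'. Q' \<in> {Q, adjoin Q \<theta>, adjoin Q \<psi>} \<Longrightarrow> faithful Q' G \<Longrightarrow> regular Q' \<eta>"
  proof (rule fresh_generic[OF G])
    show "finite {Q, adjoin Q \<theta>, adjoin Q \<psi>}" by simp
  qed (use Q t in auto)
  have r: "regular Q \<eta>" "regular (adjoin Q \<theta>) \<eta>" "regular (adjoin Q \<psi>) \<eta>"
    using \<eta>(3) fQ f\<theta> f\<psi> by auto
  have "depth_ge G r (adjoin (adjoin Q \<psi>) \<eta>)"
    by (rule Suc.IH) (use t d \<eta> r in auto)
  then have "depth_ge G (Suc r) (adjoin Q \<eta>)"
    using \<psi> regular_exchange[of Q \<psi> \<eta>] Q r by (auto simp: adjoin_commute[of Q \<eta>])
  then have "depth_ge G r (adjoin (adjoin Q \<eta>) \<theta>)"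
    using \<theta> \<eta> Q r by (intro Suc.IH tame_ideal_adjoin regular_exchange[of Q \<theta> \<eta>]) auto
  then show ?case
    using \<eta> r by (auto simp: adjoin_commute[of Q \<theta>])
qed simp

lemma depth_ge_UNIV: "depth_ge G r UNIV"
proof (induction r)
  case (Suc r)
  have "0 \<in> ideal_span G" by (simp add: is_ideal_zero)
  moreover have "adjoin UNIV 0 = (UNIV :: gpoly set)" using adjoin_superset[of UNIV 0] by auto
  ultimately show ?case using Suc tame_zero by (auto simp: regular_def intro!: bexI[of _ 0])
qed simp

lemma tame_ideal_colon:
  assumes "tame_ideal Q" "tame y"
  shows "tame_ideal {s. s * y \<in> Q}"
proof -
  have "\<forall>\<^sub>F n in sequentially. (\<forall>j. strip_closed (n, j) Q) \<and> (\<forall>j. free_of (n, j) y)"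
    using assms by (intro eventually_conj) (auto simp: tame_def tame_ideal_def)
  then have "\<forall>\<^sub>F n in sequentially. \<forall>j. strip_closed (n, j) {s. s * y \<in> Q}"
  proof eventually_elim
    case (elim n)
    then have "strip (n, j) s * y = strip (n, j) (s * y)" for j s
      unfolding free_of_def by (metis mult.commute)
    then show ?case using elim by (auto simp: strip_closed_def)
  qed
  then show ?thesis using assms by (simp add: tame_ideal_def)
qed

text \<open>
  The modules \<open>S/(Q : y)\<close>, \<open>S/Q\<close> and \<open>S/(Q + y)\<close> form a short exact sequence, and a generic element that is
  regular on the outer two is regular on the middle one. The sequence stays exact modulo that element, which
  amounts to the equation \<open>colon\<close> below.
\<close>

lemma depth_ge_extension:
  assumes G: "finite G" "\<And>g. g \<in> G \<Longrightarrow> tame g" and y: "tame y"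
  shows "tame_ideal Q \<Longrightarrow> depth_ge G r {s. s * y \<in> Q} \<Longrightarrow> depth_ge G r (adjoin Q y) \<Longrightarrow> depth_ge G r Q"
proof (induction r arbitrary: Q)
  case (Suc r)
  define C where "C = {s. s * y \<in> Q}"
  note Q = Suc.prems(1)
  have iQ: "is_ideal Q" using Q by simp
  have dC: "depth_ge G (Suc r) C" using Suc.prems(2) by (simp add: C_def)
  have dA: "depth_ge G (Suc r) (adjoin Q y)" by (rule Suc.prems(3))
  have t: "tame_ideal C" "tame_ideal (adjoin Q y)"
    unfolding C_def using Q y by (auto intro: tame_ideal_adjoin tame_ideal_colon)
  obtain \<eta> where \<eta>: "tame \<eta>" "\<eta> \<in> ideal_span G"
    "\<And>Q'. Q' \<in> {C, adjoin Q y} \<Longrightarrow> faithful Q' G \<Longrightarrow> regular Q' \<eta>"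
  proof (rule fresh_generic[OF G])
    show "finite {C, adjoin Q y}" by simp
  qed (use t in auto)
  have r: "regular C \<eta>" "regular (adjoin Q y) \<eta>"
    using \<eta>(3) depth_ge_Suc_faithful dC dA t by auto
  have reg: "regular Q \<eta>"
    unfolding regular_def
  proof (intro allI impI)
    fix z assume z: "\<eta> * z \<in> Q"
    then have "z \<in> adjoin Q y" using r(2) adjoin_superset by (blast intro: regularD)
    then obtain s where s: "z - s * y \<in> Q" by (auto simp: adjoin_iff)
    have "\<eta> * s * y = \<eta> * z - \<eta> * (z - s * y)" by (simp add: algebra_simps)
    also have "\<dots> \<in> Q" by (rule is_ideal_diff[OF iQ z is_ideal_mult[OF iQ s]])
    finally have "s \<in> C" using regularD[OF r(1)] by (simp add: C_def)
    then have "s * y \<in> Q" by (simp add: C_def)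
    from is_ideal_add[OF iQ s this] show "z \<in> Q" by simp
  qed
  have colon: "{s. s * y \<in> adjoin Q \<eta>} = adjoin C \<eta>"
  proof (intro set_eqI iffI)
    fix s assume "s \<in> {s. s * y \<in> adjoin Q \<eta>}"
    then obtain z where z: "s * y - z * \<eta> \<in> Q" by (auto simp: adjoin_iff)
    have "\<eta> * z - s * y \<in> Q" using is_ideal_mult[OF iQ z, of "-1"] by (simp add: algebra_simps)
    then have "\<eta> * z \<in> adjoin Q y" by (auto simp: adjoin_iff)
    then have "z \<in> adjoin Q y" using r(2) by (blast intro: regularD)
    then obtain u where u: "z - u * y \<in> Q" by (auto simp: adjoin_iff)
    have "(s - u * \<eta>) * y = (s * y - z * \<eta>) + \<eta> * (z - u * y)" by (simp add: algebra_simps)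
    also have "\<dots> \<in> Q" by (rule is_ideal_add[OF iQ z is_ideal_mult[OF iQ u]])
    finally show "s \<in> adjoin C \<eta>" by (auto simp: adjoin_iff C_def)
  next
    fix s assume "s \<in> adjoin C \<eta>"
    then obtain u where "(s - u * \<eta>) * y \<in> Q" by (auto simp: adjoin_iff C_def)
    then have "s * y - (u * y) * \<eta> \<in> Q" by (simp add: algebra_simps)
    then show "s \<in> {s. s * y \<in> adjoin Q \<eta>}" by (auto simp: adjoin_iff)
  qed
  have "depth_ge G r (adjoin Q \<eta>)"
  proof (rule Suc.IH)
    show "tame_ideal (adjoin Q \<eta>)" using Q \<eta> by (intro tame_ideal_adjoin)
    show "depth_ge G r {s. s * y \<in> adjoin Q \<eta>}"
      unfolding colon by (rule depth_ge_adjoin[OF G]) (use t dC \<eta> r in auto)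
    show "depth_ge G r (adjoin (adjoin Q \<eta>) y)"
      unfolding adjoin_commute[of Q \<eta>] by (rule depth_ge_adjoin[OF G]) (use t dA \<eta> r in auto)
  qed
  then show ?case using \<eta> reg by auto
qed simp

text \<open>
  A generic element \<open>\<theta>\<close> of \<open>hs\<close> does not lower the depth of \<open>G\<close> as long as \<open>G\<close> and \<open>hs\<close> together have greater
  depth. A generic \<open>\<eta>\<close> of \<open>G\<close> remains regular modulo \<open>\<theta>\<close>: otherwise, by swapping, some class modulo \<open>\<eta>\<close> would
  be killed by \<open>G\<close> and by \<open>\<theta>\<close>, and then, by McCoy, some class would be killed by \<open>G\<close> and all of \<open>hs\<close>. Now
  factor out \<open>\<eta>\<close> and use induction.
\<close>

lemma depth_ge_adjoin_generic:
  assumes G: "finite G" "\<And>g. g \<in> G \<Longrightarrow> tame g"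
    and hs: "\<And>h. h \<in> set hs \<Longrightarrow> tame h"
    and free: "\<And>g j. g \<in> G \<union> set hs \<Longrightarrow> free_of (n, j) g"
  shows "tame_ideal Q \<Longrightarrow> (\<And>j. strip_closed (n, j) Q) \<Longrightarrow> depth_ge G r Q
      \<Longrightarrow> depth_ge (G \<union> set hs) (Suc r) Q \<Longrightarrow> regular Q (generic n hs)
      \<Longrightarrow> depth_ge G r (adjoin Q (generic n hs))"
proof (induction r arbitrary: Q)
  case (Suc r)
  define \<theta> where "\<theta> = generic n hs"
  note Q = Suc.prems(1) and st = Suc.prems(2)
  have iQ: "is_ideal Q" using Q by simp
  have \<theta>: "tame \<theta>" "regular Q \<theta>" using hs Suc.prems(5) by (auto simp: \<theta>_def intro: tame_generic)
  have GH: "finite (G \<union> set hs)" "\<And>g. g \<in> G \<union> set hs \<Longrightarrow> tame g" using G hs by auto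
  have fQ: "faithful Q G" using Suc.prems(3) iQ by (intro depth_ge_Suc_faithful) auto
  \<comment> \<open>a second generic element, this time of \<open>G\<close>, whose block is fresh for everything else\<close>
  obtain gs where gs: "set gs = G" using finite_list[OF G(1)] by blast
  have tQ\<theta>: "tame_ideal (adjoin Q \<theta>)" using Q \<theta> by (auto intro: tame_ideal_adjoin)
  have "\<forall>\<^sub>F k in sequentially. (\<forall>g\<in>G. \<forall>j. free_of (k, j) g) \<and> (\<forall>j. strip_closed (k, j) Q)
      \<and> (\<forall>j. strip_closed (k, j) (adjoin Q \<theta>)) \<and> n < k"
    using G(2) Q tQ\<theta> by (intro eventually_conj eventually_ball_finite G(1) eventually_gt_at_top ballI)
      (auto simp: tame_def tame_ideal_def)
  then obtain k where k: "\<forall>g\<in>G. \<forall>j. free_of (k, j) g" "\<forall>j. strip_closed (k, j) Q"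
      "\<forall>j. strip_closed (k, j) (adjoin Q \<theta>)" "n < k"
    by (auto simp: eventually_sequentially)
  define \<eta> where "\<eta> = generic k gs"
  have \<eta>: "tame \<eta>" "\<eta> \<in> ideal_span G"
    using G gs by (auto simp: \<eta>_def intro: tame_generic generic_in_span)
  have \<eta>Q: "regular Q \<eta>"
    unfolding \<eta>_def using iQ k fQ gs by (intro generic_regular) auto
  have \<eta>GH: "\<eta> \<in> ideal_span (G \<union> set hs)" using \<eta>(2) ideal_span_mono[of G "G \<union> set hs"] by auto
  have d1: "depth_ge (G \<union> set hs) (Suc r) (adjoin Q \<eta>)"
    by (rule depth_ge_adjoin[OF GH]) (use Q Suc.prems(4) \<eta> \<eta>Q \<eta>GH in auto)
  have d0: "depth_ge G r (adjoin Q \<eta>)"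
    by (rule depth_ge_adjoin[OF G]) (use Q Suc.prems(3) \<eta> \<eta>Q in auto)
  have tQ\<eta>: "tame_ideal (adjoin Q \<eta>)" using Q \<eta> by (auto intro: tame_ideal_adjoin)
  have "free_of (n, j) \<eta>" for j
    unfolding \<eta>_def generic_def using k(4) free gs
    by (intro free_of_sum free_of_mult free_of_var) auto
  then have st\<eta>: "strip_closed (n, j) (adjoin Q \<eta>)" for j
    using iQ st by (intro strip_closed_adjoin)
  have fGH: "faithful (adjoin Q \<eta>) (G \<union> set hs)"
    using d1 tQ\<eta> by (intro depth_ge_Suc_faithful) auto
  have f\<theta>: "faithful (adjoin Q \<theta>) G"
  proof (rule faithful_swap[OF iQ \<theta>(2) \<eta>Q \<eta>(2)])
    fix w assume w: "\<And>g. g \<in> G \<Longrightarrow> g * w \<in> adjoin Q \<eta>" "\<theta> * w \<in> adjoin Q \<eta>"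
    show "w \<in> adjoin Q \<eta>"
    proof (rule ccontr)
      assume "w \<notin> adjoin Q \<eta>"
      then obtain r where r: "r * w \<notin> adjoin Q \<eta>" "\<forall>h\<in>set hs. h * (r * w) \<in> adjoin Q \<eta>"
        using generic_zero_divisor[of "adjoin Q \<eta>" n hs w] w(2) iQ st\<eta> free
        unfolding \<theta>_def by auto
      have "g * (r * w) \<in> adjoin Q \<eta>" if "g \<in> G \<union> set hs" for g
      proof (cases "g \<in> set hs")
        case False
        with that have "g \<in> G" by simp
        then show ?thesis
          using is_ideal_mult[OF is_ideal_adjoin[OF iQ] w(1), of g r] by (simp add: ac_simps)
      qed (use r(2) in blast)
      then have "r * w \<in> adjoin Q \<eta>" by (rule faithfulD[OF fGH])
      with r(1) show False ..
    qed
  qed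
  have reg\<eta>: "regular (adjoin Q \<theta>) \<eta>"
    unfolding \<eta>_def using iQ k f\<theta> gs by (intro generic_regular) auto
  have reg\<theta>: "regular (adjoin Q \<eta>) \<theta>" using iQ \<theta>(2) reg\<eta> by (rule regular_exchange)
  have "depth_ge G r (adjoin (adjoin Q \<eta>) \<theta>)"
    unfolding \<theta>_def by (rule Suc.IH) (use tQ\<eta> st\<eta> d0 d1 reg\<theta> in \<open>auto simp: \<theta>_def\<close>)
  then have "depth_ge G (Suc r) (adjoin Q \<theta>)"
    using \<eta> reg\<eta> by (auto simp: adjoin_commute[of Q \<theta>])
  then show ?case by (simp add: \<theta>_def)
qed simp

section \<open>Depth of monomial ideals\<close>

lemma ideal_span_empty: "ideal_span {} = {0}"
  using ideal_span_least[of "{0}" "{}"] by (auto simp: is_ideal_zero)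

lemma ideal_span_insert: "ideal_span (insert \<theta> G) = adjoin (ideal_span G) \<theta>"
proof
  show "ideal_span (insert \<theta> G) \<subseteq> adjoin (ideal_span G) \<theta>"
    using adjoin_superset[of "ideal_span G" \<theta>] ideal_span_superset[of G]
    by (intro ideal_span_least) (auto intro: adjoin_self)
  show "adjoin (ideal_span G) \<theta> \<subseteq> ideal_span (insert \<theta> G)"
  proof
    fix x assume "x \<in> adjoin (ideal_span G) \<theta>"
    then obtain q r where "q \<in> ideal_span G" "x = q + r * \<theta>" by (rule adjoinE)
    then show "x \<in> ideal_span (insert \<theta> G)"
      using ideal_span_mono[of G "insert \<theta> G"] ideal_span_superset[of "insert \<theta> G"]
      by (auto intro!: is_ideal_add[OF is_ideal_span] is_ideal_mult[OF is_ideal_span])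
  qed
qed

lemma strip_closed_zero: "strip_closed v {0}"
  by (simp add: strip_closed_def strip_zero)

lemma tame_ideal_zero: "tame_ideal {0}"
  by (simp add: tame_ideal_def strip_closed_zero)

lemma strip_closed_span:
  assumes "finite G" "\<And>g. g \<in> G \<Longrightarrow> free_of v g"
  shows "strip_closed v (ideal_span G)"
  using assms by (induction G rule: finite_induct)
    (auto simp: ideal_span_empty strip_closed_zero ideal_span_insert intro: strip_closed_adjoin)

lemma tame_ideal_span:
  assumes "finite G" "\<And>g. g \<in> G \<Longrightarrow> tame g"
  shows "tame_ideal (ideal_span G)"
  using assms by (induction G rule: finite_induct)
    (auto simp: ideal_span_empty tame_ideal_zero ideal_span_insert intro: tame_ideal_adjoin)

abbreviation x_ideal :: "nat set \<Rightarrow> gpoly set" where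
  "x_ideal A \<equiv> ideal_span ((\<lambda>j. var (0, j)) ` A)"

lemma regular_x_ideal_var:
  assumes "finite A" "j \<notin> A"
  shows "regular (x_ideal A) (var (0, j))"
proof -
  have "strip_closed (0, j) (x_ideal A)"
    using assms by (intro strip_closed_span) (auto intro!: free_of_var)
  then show ?thesis
    unfolding regular_def strip_closed_def using strip_var_mult by metis
qed

lemma regular_power: "regular Q g \<Longrightarrow> regular Q (g ^ e)"
  by (induction e) (auto intro: regular_one regular_mult)

lemma regular_prod: "(\<And>i. i \<in> I \<Longrightarrow> regular Q (f i)) \<Longrightarrow> regular Q (prod f I)"
  by (induction I rule: infinite_finite_induct) (auto intro: regular_one regular_mult)

text \<open>
  The quotient \<open>S/(A, x j * y)\<close> is an extension of \<open>S/(A, x j)\<close> by \<open>S/(A, y)\<close>. Repeated use filters the quotient by a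
  monomial with pieces that are polynomial rings in fewer variables.
\<close>

lemma depth_ge_x_ideal_mult:
  assumes G: "finite G" "\<And>g. g \<in> G \<Longrightarrow> tame g"
    and A: "finite A" "j \<notin> A" and y: "tame y"
    and d: "depth_ge G r (adjoin (x_ideal A) y)" and d': "depth_ge G r (x_ideal (insert j A))"
  shows "depth_ge G r (adjoin (x_ideal A) (var (0, j) * y))"
proof (rule depth_ge_extension[OF G tame_var[of 0 j]])
  let ?Q = "x_ideal A" and ?x = "var (0, j)"
  show "tame_ideal (adjoin ?Q (?x * y))"
    using A y by (intro tame_ideal_adjoin tame_ideal_span tame_mult tame_var) (auto intro: tame_var)
  have "{s. s * ?x \<in> adjoin ?Q (?x * y)} = adjoin ?Q y"
  proof (intro set_eqI iffI)
    fix s assume "s \<in> {s. s * ?x \<in> adjoin ?Q (?x * y)}"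
    then obtain u where "s * ?x - u * (?x * y) \<in> ?Q" by (auto simp: adjoin_iff)
    then have "?x * (s - u * y) \<in> ?Q" by (simp add: algebra_simps)
    then have "s - u * y \<in> ?Q" using regular_x_ideal_var[OF A] by (blast intro: regularD)
    then show "s \<in> adjoin ?Q y" by (auto simp: adjoin_iff)
  next
    fix s assume "s \<in> adjoin ?Q y"
    then obtain u where "s - u * y \<in> ?Q" by (auto simp: adjoin_iff)
    then have "?x * (s - u * y) \<in> ?Q" by (simp add: is_ideal_mult)
    then have "s * ?x - u * (?x * y) \<in> ?Q" by (simp add: algebra_simps)
    then show "s \<in> {s. s * ?x \<in> adjoin ?Q (?x * y)}" by (auto simp: adjoin_iff)
  qed
  then show "depth_ge G r {s. s * ?x \<in> adjoin ?Q (?x * y)}" using d by simp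
  have "adjoin (adjoin ?Q (?x * y)) ?x = adjoin ?Q ?x"
  proof -
    have i: "is_ideal (adjoin ?Q ?x)" by simp
    have "?x * y \<in> adjoin ?Q ?x"
      using is_ideal_mult'[OF i adjoin_self[OF is_ideal_span]] .
    then have "adjoin (adjoin ?Q ?x) (?x * y) \<subseteq> adjoin ?Q ?x"
      by (auto elim!: adjoinE[of _ "adjoin ?Q ?x"] intro!: is_ideal_add[OF i] is_ideal_mult[OF i])
    then show ?thesis
      using adjoin_superset[of "adjoin ?Q ?x" "?x * y"] by (simp add: adjoin_commute[of ?Q "?x * y"])
  qed
  also have "\<dots> = x_ideal (insert j A)" by (simp add: ideal_span_insert)
  finally show "depth_ge G r (adjoin (adjoin ?Q (?x * y)) ?x)" using d' by simp
qed

text \<open>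
  Combinatorial bound for the depth on the polynomial ring in the variables \<open>V - A\<close>: a set \<open>J\<close> with
  \<open>card (V - A) < card J + r\<close> is a coordinate subspace of codimension less than \<open>r\<close>, and some monomial of \<open>G\<close> must
  not vanish on it. For \<open>J = V - A\<close> this gives a regular monomial, and modulo the monomial the ring is built
  from polynomial rings in one variable less, to which the induction hypothesis applies.
\<close>

lemma depth_ge_monomials:
  assumes G: "finite G" "\<And>g. g \<in> G \<Longrightarrow> tame g" and V: "finite V"
  shows "A \<subseteq> V \<Longrightarrow>
    (\<And>J. J \<subseteq> V - A \<Longrightarrow> card (V - A) < card J + r \<Longrightarrow> \<exists>\<alpha>. (\<Prod>j\<in>J. var (0, j) ^ \<alpha> j) \<in> G)
    \<Longrightarrow> depth_ge G r (x_ideal A)"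
proof (induction r arbitrary: A)
  case (Suc r)
  have A: "finite A" using Suc.prems(1) V by (rule finite_subset)
  obtain \<alpha> where \<alpha>: "(\<Prod>j\<in>V - A. var (0, j) ^ \<alpha> j) \<in> G"
    using Suc.prems(2)[of "V - A"] by auto
  have IH: "depth_ge G r (x_ideal (insert j A))" if "j \<in> V - A" for j
  proof (rule Suc.IH)
    fix J assume J: "J \<subseteq> V - insert j A" "card (V - insert j A) < card J + r"
    have "V - insert j A = (V - A) - {j}" by auto
    then have "card (V - A) = Suc (card (V - insert j A))"
      using that V by (metis card_Suc_Diff1 finite_Diff)
    then show "\<exists>\<alpha>. (\<Prod>j\<in>J. var (0, j) ^ \<alpha> j) \<in> G"
      using J by (intro Suc.prems(2)) auto
  qed (use that Suc.prems in auto)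
  have step: "depth_ge G r (adjoin (x_ideal A) (var (0, j) ^ e * y))"
    if "j \<in> V - A" "tame y" "depth_ge G r (adjoin (x_ideal A) y)" for j e y
  proof (induction e)
    case (Suc e)
    have "depth_ge G r (adjoin (x_ideal A) (var (0, j) * (var (0, j) ^ e * y)))"
      using that A Suc IH by (intro depth_ge_x_ideal_mult[OF G] tame_mult tame_power tame_var) auto
    then show ?case by (simp add: mult.assoc)
  qed (use that in simp)
  have "depth_ge G r (adjoin (x_ideal A) (\<Prod>j\<in>S. var (0, j) ^ \<alpha> j))" if "S \<subseteq> V - A" for S
  proof -
    have "finite S" using that V by (auto intro: finite_subset)
    then show ?thesis using that
    proof (induction S rule: finite_induct)
      case empty
      then show ?case by (simp add: adjoin_one depth_ge_UNIV)
    next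
      case (insert j S)
      then show ?case
        by (simp, intro step) (auto intro!: tame_prod tame_power tame_var)
    qed
  qed
  from this[of "V - A"] have "depth_ge G r (adjoin (x_ideal A) (\<Prod>j\<in>V - A. var (0, j) ^ \<alpha> j))"
    by simp
  moreover have "regular (x_ideal A) (\<Prod>j\<in>V - A. var (0, j) ^ \<alpha> j)"
    using A by (intro regular_prod regular_power regular_x_ideal_var) auto
  ultimately show ?case
    using \<alpha> G ideal_span_superset[of G] by auto
qed simp

section \<open>Regular sequences of generic forms\<close>

text \<open>
  Block \<open>0\<close> is taken by the variables \<open>x j\<close>, hence the shift: the coefficients of the \<open>i\<close>-th form are in block
  \<open>Suc i\<close>.
\<close>

primrec generic_ideal :: "(nat \<Rightarrow> gpoly list) \<Rightarrow> nat \<Rightarrow> gpoly set" where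
  "generic_ideal gs 0 = {0}"
| "generic_ideal gs (Suc i) = adjoin (generic_ideal gs i) (generic (Suc i) (gs i))"

lemma free_of_generic:
  assumes "n \<noteq> k" "\<And>g. g \<in> set gs \<Longrightarrow> free_of (n, j) g"
  shows "free_of (n, j) (generic k gs)"
  unfolding generic_def using assms by (intro free_of_sum free_of_mult free_of_var) auto

text \<open>
  The depth assumption for all sets \<open>T\<close> of forms is inherited by the forms not yet used each time a generic
  form is factored out: for \<open>T\<close> among the remaining ones, \<open>depth_ge_adjoin_generic\<close> uses the assumptions for \<open>T\<close>
  and for \<open>T\<close> with the current form. The singleton sets then give regularity.
\<close>

lemma generic_ideal_regular:
  assumes free: "\<And>i n j g. i < m \<Longrightarrow> g \<in> set (gs i) \<Longrightarrow> 0 < n \<Longrightarrow> free_of (n, j) g"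
    and depth: "\<And>T. T \<subseteq> {..<m} \<Longrightarrow> depth_ge (\<Union>i\<in>T. set (gs i)) (card T) {0}"
    and "i < m"
  shows "regular (generic_ideal gs i) (generic (Suc i) (gs i))"
proof -
  have tame: "tame g" if "i < m" "g \<in> set (gs i)" for i g
    unfolding tame_def using eventually_gt_at_top[of 0]
    by (rule eventually_mono) (use that free in auto)
  have tQ: "tame_ideal (generic_ideal gs i)" if "i \<le> m" for i
    using that by (induction i) (auto intro!: tame_ideal_zero tame_ideal_adjoin tame_generic tame)
  have stQ: "strip_closed (Suc i, j) (generic_ideal gs i')" if "i' \<le> i" "i < m" for i i' j
    using that
  proof (induction i')
    case (Suc i')
    then show ?case
      using tQ[of i'] by (auto intro!: strip_closed_adjoin free_of_generic free[of i'])
  qed (simp add: strip_closed_zero)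
  have regular: "regular (generic_ideal gs i) (generic (Suc i) (gs i))"
    if "i < m" "\<And>T. T \<subseteq> {i..<m} \<Longrightarrow> depth_ge (\<Union>i\<in>T. set (gs i)) (card T) (generic_ideal gs i)" for i
  proof (rule generic_regular)
    have "depth_ge (set (gs i)) (Suc 0) (generic_ideal gs i)" using that(2)[of "{i}"] that(1) by simp
    then show "faithful (generic_ideal gs i) (set (gs i))"
      using tQ[of i] that(1) by (intro depth_ge_Suc_faithful[of _ _ 0]) auto
  qed (use that tQ[of i] stQ free in auto)
  have "T \<subseteq> {i..<m} \<Longrightarrow> depth_ge (\<Union>i\<in>T. set (gs i)) (card T) (generic_ideal gs i)"
    if "i \<le> m" for i T
    using that
  proof (induction i arbitrary: T)
    case 0
    then show ?case using depth[of T] by (auto simp: atLeast0LessThan)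
  next
    case (Suc i)
    have T: "finite T" "T \<subseteq> {..<m}" "i \<notin> T" "insert i T \<subseteq> {i..<m}"
      using Suc.prems by (auto intro: finite_subset)
    have "depth_ge (\<Union>i\<in>insert i T. set (gs i)) (card (insert i T)) (generic_ideal gs i)"
      using Suc T by (intro Suc.IH) auto
    moreover have "(\<Union>i\<in>insert i T. set (gs i)) = (\<Union>i\<in>T. set (gs i)) \<union> set (gs i)" by auto
    ultimately have d1: "depth_ge ((\<Union>i\<in>T. set (gs i)) \<union> set (gs i)) (Suc (card T)) (generic_ideal gs i)"
      using T by simp
    have d0: "depth_ge (\<Union>i\<in>T. set (gs i)) (card T) (generic_ideal gs i)"
      using Suc T by (intro Suc.IH) auto
    have "regular (generic_ideal gs i) (generic (Suc i) (gs i))"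
      using Suc by (intro regular Suc.IH) auto
    then show ?case
      unfolding generic_ideal.simps
    proof (intro depth_ge_adjoin_generic)
      show "tame h" if "h \<in> set (gs i)" for h
        using tame[of i h] that Suc.prems by simp
      show "free_of (Suc i, j) g" if "g \<in> (\<Union>i\<in>T. set (gs i)) \<union> set (gs i)" for g j
      proof -
        have "\<exists>k\<in>insert i T. g \<in> set (gs k)" using that by auto
        moreover have "insert i T \<subseteq> {..<m}" using T(2) Suc.prems by auto
        ultimately obtain k where "k < m" "g \<in> set (gs k)" by auto
        then show ?thesis by (intro free) auto
      qed
    qed (use T Suc.prems d0 d1 tQ[of i] stQ[of i i] tame in \<open>auto simp: subset_iff\<close>)
  qed
  then show ?thesis using assms(3) by (intro regular) auto
qed

section \<open>The bigraded Hilbert function\<close>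

text \<open>
  Degrees are integers so that degree shifts can be subtracted freely; in negative degrees there are no
  monomials.
\<close>

definition weighted_monomials ::
    "(nat \<times> nat) set \<Rightarrow> (nat \<times> nat \<Rightarrow> nat) \<Rightarrow> (nat \<times> nat \<Rightarrow> nat) \<Rightarrow> int \<Rightarrow> int
      \<Rightarrow> ((nat \<times> nat) \<Rightarrow>\<^sub>0 nat) set" where
  "weighted_monomials V xw uw t s = {\<mu>. Poly_Mapping.keys \<mu> \<subseteq> V
     \<and> int (\<Sum>v\<in>V. Poly_Mapping.lookup \<mu> v * xw v) = t
     \<and> int (\<Sum>v\<in>V. Poly_Mapping.lookup \<mu> v * uw v) = s}"

locale bigrading =
  fixes V :: "(nat \<times> nat) set" and xw uw :: "nat \<times> nat \<Rightarrow> nat"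
  assumes finite_V: "finite V" and weight_pos: "\<And>v. v \<in> V \<Longrightarrow> 0 < xw v + uw v"
begin

abbreviation monomials :: "int \<Rightarrow> int \<Rightarrow> ((nat \<times> nat) \<Rightarrow>\<^sub>0 nat) set" where
  "monomials \<equiv> weighted_monomials V xw uw"

definition part :: "int \<Rightarrow> int \<Rightarrow> gpoly \<Rightarrow> gpoly" where
  "part t s p = Poly_Mapping.mapp (\<lambda>\<mu> c. if \<mu> \<in> monomials t s then c else 0) p"

definition piece :: "int \<Rightarrow> int \<Rightarrow> gpoly set" where
  "piece t s = {p. Poly_Mapping.keys p \<subseteq> monomials t s}"

text \<open>
  Homogeneity in terms of the projections \<open>part\<close>, which also discard all monomials with a variable outside
  \<open>V\<close>. It thus includes that \<open>g\<close> involves only variables of \<open>V\<close>.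
\<close>

definition homogeneous :: "gpoly \<Rightarrow> int \<Rightarrow> int \<Rightarrow> bool" where
  "homogeneous g a c \<longleftrightarrow> (\<forall>t s p. part t s (g * p) = g * part (t - a) (s - c) p)"

definition graded_ideal :: "gpoly set \<Rightarrow> bool" where
  "graded_ideal Q \<longleftrightarrow> is_ideal Q \<and> (\<forall>t s. \<forall>p\<in>Q. part t s p \<in> Q)"

lemma lookup_part:
  "Poly_Mapping.lookup (part t s p) \<mu> = (if \<mu> \<in> monomials t s then Poly_Mapping.lookup p \<mu> else 0)"
  by (simp add: part_def lookup_mapp in_keys_iff when_def)

lemma part_add: "part t s (p + q) = part t s p + part t s q"
  by (rule poly_mapping_eqI) (simp add: lookup_part lookup_add)

lemma part_in_piece: "part t s p \<in> piece t s"
  by (auto simp: piece_def in_keys_iff lookup_part split: if_splits)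

lemma part_piece: "p \<in> piece t s \<Longrightarrow> part t s p = p"
  by (rule poly_mapping_eqI) (auto simp: piece_def in_keys_iff lookup_part)

lemma monomials_shift:
  assumes "v \<in> V"
  shows "Poly_Mapping.single v 1 + \<nu> \<in> monomials t s \<longleftrightarrow>
         \<nu> \<in> monomials (t - int (xw v)) (s - int (uw v))"
proof -
  have keys: "Poly_Mapping.keys (Poly_Mapping.single v 1 + \<nu>) = insert v (Poly_Mapping.keys \<nu>)"
    by (auto simp: in_keys_iff lookup_add lookup_single when_def split: if_splits)
  have sums: "(\<Sum>u\<in>V. Poly_Mapping.lookup (Poly_Mapping.single v 1 + \<nu>) u * w u)
      = w v + (\<Sum>u\<in>V. Poly_Mapping.lookup \<nu> u * w u)" for w :: "nat \<times> nat \<Rightarrow> nat"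
  proof -
    have "(\<Sum>u\<in>V. Poly_Mapping.lookup (Poly_Mapping.single v 1 + \<nu>) u * w u)
        = (\<Sum>u\<in>V. (if u = v then w v else 0) + Poly_Mapping.lookup \<nu> u * w u)"
      by (intro sum.cong refl) (auto simp: lookup_add lookup_single when_def)
    then show ?thesis using assms finite_V by (simp add: sum.distrib)
  qed
  show ?thesis
    unfolding weighted_monomials_def mem_Collect_eq keys sums of_nat_add using assms by auto
qed

lemma homogeneous_var:
  assumes "v \<in> V"
  shows "homogeneous (var v) (int (xw v)) (int (uw v))"
  unfolding homogeneous_def
proof (intro allI poly_mapping_eqI)
  fix t s p \<mu>
  have "\<mu> \<in> monomials t s \<longleftrightarrow>
      \<mu> - Poly_Mapping.single v 1 \<in> monomials (t - int (xw v)) (s - int (uw v))"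
    if "Poly_Mapping.lookup \<mu> v \<noteq> 0"
  proof -
    have "Poly_Mapping.single v 1 + (\<mu> - Poly_Mapping.single v 1) = \<mu>"
      using that by (intro poly_mapping_eqI) (auto simp: lookup_add lookup_minus lookup_single when_def)
    then show ?thesis using monomials_shift[OF assms, of "\<mu> - Poly_Mapping.single v 1" t s] by simp
  qed
  then show "Poly_Mapping.lookup (part t s (var v * p)) \<mu>
      = Poly_Mapping.lookup (var v * part (t - int (xw v)) (s - int (uw v)) p) \<mu>"
    by (auto simp: lookup_part lookup_var_mult)
qed

lemma homogeneous_mult:
  "homogeneous g a c \<Longrightarrow> homogeneous h a' c' \<Longrightarrow> homogeneous (g * h) (a + a') (c + c')"
  by (simp add: homogeneous_def mult.assoc diff_diff_eq)

lemma homogeneous_one: "homogeneous 1 0 0"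
  by (simp add: homogeneous_def)

lemma homogeneous_power: "homogeneous g a c \<Longrightarrow> homogeneous (g ^ e) (int e * a) (int e * c)"
proof (induction e)
  case (Suc e)
  then show ?case using homogeneous_mult[of g a c "g ^ e" "int e * a" "int e * c"]
    by (simp add: ring_distribs)
qed (simp add: homogeneous_one)

lemma homogeneous_prod:
  "(\<And>i. i \<in> I \<Longrightarrow> homogeneous (f i) (a i) (c i)) \<Longrightarrow> homogeneous (prod f I) (sum a I) (sum c I)"
  by (induction I rule: infinite_finite_induct) (auto intro: homogeneous_one homogeneous_mult)

lemma homogeneous_sum:
  "(\<And>i. i \<in> I \<Longrightarrow> homogeneous (f i) a c) \<Longrightarrow> homogeneous (sum f I) a c"
proof (induction I rule: infinite_finite_induct)
  case (insert i I)
  then have "homogeneous (f i) a c" "homogeneous (sum f I) a c" by auto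
  then show ?case using insert.hyps
    unfolding homogeneous_def by (simp add: distrib_right part_add)
qed (auto simp: homogeneous_def part_def intro!: poly_mapping_eqI simp: lookup_mapp)

lemma graded_ideal_zero: "graded_ideal {0}"
  by (auto simp: graded_ideal_def intro!: poly_mapping_eqI simp: lookup_part)

lemma graded_ideal_adjoin:
  assumes "graded_ideal Q" "homogeneous \<theta> a c"
  shows "graded_ideal (adjoin Q \<theta>)"
  unfolding graded_ideal_def
proof (intro conjI allI ballI)
  show "is_ideal (adjoin Q \<theta>)" using assms by (simp add: graded_ideal_def)
  fix t s p assume "p \<in> adjoin Q \<theta>"
  then obtain q r where p: "q \<in> Q" "p = q + r * \<theta>" by (rule adjoinE)
  have "part t s (\<theta> * r) = \<theta> * part (t - a) (s - c) r" using assms(2) by (simp add: homogeneous_def)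
  then have "part t s p = part t s q + part (t - a) (s - c) r * \<theta>"
    using p by (simp add: part_add mult.commute)
  moreover have "part t s q \<in> Q" using p assms by (auto simp: graded_ideal_def)
  ultimately show "part t s p \<in> adjoin Q \<theta>" unfolding adjoin_def by blast
qed

lemma finite_monomials: "finite (monomials t s)"
proof -
  define N where "N = nat (t + s)"
  have "inj_on Poly_Mapping.lookup (monomials t s)"
    by (auto simp: inj_on_def)
  moreover have "Poly_Mapping.lookup ` monomials t s \<subseteq>
      {f. \<forall>v. (v \<in> V \<longrightarrow> f v \<in> {..N}) \<and> (v \<notin> V \<longrightarrow> f v = 0)}"
  proof clarsimp
    fix \<mu> i j assume \<mu>: "\<mu> \<in> monomials t s"
    have "Poly_Mapping.lookup \<mu> (i, j) \<le> N" if "(i, j) \<in> V"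
    proof -
      have "Poly_Mapping.lookup \<mu> (i, j) \<le> Poly_Mapping.lookup \<mu> (i, j) * (xw (i, j) + uw (i, j))"
        using mult_le_mono2[of 1 "xw (i, j) + uw (i, j)"] weight_pos[OF that] by (simp add: Suc_le_eq)
      also have "\<dots> \<le> (\<Sum>v\<in>V. Poly_Mapping.lookup \<mu> v * (xw v + uw v))"
        using finite_V that by (intro member_le_sum) auto
      also have "\<dots> = N"
        using \<mu> unfolding weighted_monomials_def mem_Collect_eq N_def distrib_left sum.distrib by linarith
      finally show ?thesis .
    qed
    moreover have "Poly_Mapping.lookup \<mu> (i, j) = 0" if "(i, j) \<notin> V"
      using \<mu> that by (auto simp: weighted_monomials_def in_keys_iff)
    ultimately show "((i, j) \<in> V \<longrightarrow> Poly_Mapping.lookup \<mu> (i, j) \<le> N) \<and>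
        ((i, j) \<notin> V \<longrightarrow> Poly_Mapping.lookup \<mu> (i, j) = 0)" by blast
  qed
  moreover have "finite {f. \<forall>v. (v \<in> V \<longrightarrow> f v \<in> {..N}) \<and> (v \<notin> V \<longrightarrow> f v = (0::nat))}"
    using finite_V by (intro finite_set_of_finite_funs) auto
  ultimately show ?thesis by (rule inj_on_finite)
qed

lemma bij_keys_piece: "bij_betw Poly_Mapping.keys (piece t s) (Pow (monomials t s))"
proof (rule bij_betw_byWitness[where f' = "\<lambda>F. \<Sum>\<mu>\<in>F. Poly_Mapping.single \<mu> 1"])
  have eq: "Poly_Mapping.lookup (\<Sum>\<mu>\<in>F. Poly_Mapping.single \<mu> (1::bit)) \<nu> = (if \<nu> \<in> F then 1 else 0)"
    if "finite F" for F :: "((nat \<times> nat) \<Rightarrow>\<^sub>0 nat) set" and \<nu>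
    using that by (simp add: lookup_sum lookup_single when_def)
  show "\<forall>p\<in>piece t s. (\<Sum>\<mu>\<in>Poly_Mapping.keys p. Poly_Mapping.single \<mu> 1) = p"
    by (intro ballI poly_mapping_eqI) (simp add: eq in_keys_iff)
  show keys: "\<forall>F\<in>Pow (monomials t s). Poly_Mapping.keys (\<Sum>\<mu>\<in>F. Poly_Mapping.single \<mu> (1::bit)) = F"
    using finite_subset[OF _ finite_monomials] by (auto simp: in_keys_iff eq split: if_splits)
  show "(\<lambda>F. \<Sum>\<mu>\<in>F. Poly_Mapping.single \<mu> 1) ` Pow (monomials t s) \<subseteq> piece t s"
    using keys by (auto simp: piece_def)
qed (auto simp: piece_def)

lemma finite_piece: "finite (piece t s)"
  using bij_betw_finite[OF bij_keys_piece] finite_monomials by simp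

lemma card_piece: "card (piece t s) = 2 ^ card (monomials t s)"
  using bij_betw_same_card[OF bij_keys_piece] finite_monomials by (simp add: card_Pow)

text \<open>
  The dimension over the field with two elements of the bigraded piece of \<open>S/Q\<close>, as the logarithm of an index
  of finite groups.
\<close>

definition hilbert :: "gpoly set \<Rightarrow> int \<Rightarrow> int \<Rightarrow> real" where
  "hilbert Q t s = log 2 (card (piece t s) / card (Q \<inter> piece t s))"

lemma zero_in_piece: "0 \<in> piece t s"
  by (simp add: piece_def)

lemma card_ideal_piece_pos: "is_ideal Q \<Longrightarrow> 0 < card (Q \<inter> piece t s)"
  using zero_in_piece[of t s] is_ideal_zero[of Q] finite_piece[of t s] by (auto simp: card_gt_0_iff)

lemma hilbert_nonneg:
  assumes "is_ideal Q"
  shows "0 \<le> hilbert Q t s"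
proof -
  have "card (Q \<inter> piece t s) \<le> card (piece t s)" by (intro card_mono finite_piece) auto
  then show ?thesis using card_ideal_piece_pos[OF assms, of t s] by (simp add: hilbert_def)
qed

lemma hilbert_zero: "hilbert {0} t s = card (monomials t s)"
proof -
  have "{0} \<inter> piece t s = {0}" using zero_in_piece by auto
  then show ?thesis by (simp add: hilbert_def card_piece)
qed

lemma piece_add: "p \<in> piece t s \<Longrightarrow> q \<in> piece t s \<Longrightarrow> p + q \<in> piece t s"
  by (metis part_add part_in_piece part_piece)

lemma part_diff: "part t s (p - q) = part t s p - part t s q"
  by (rule poly_mapping_eqI) (simp add: lookup_part lookup_minus)

lemma piece_diff: "p \<in> piece t s \<Longrightarrow> q \<in> piece t s \<Longrightarrow> p - q \<in> piece t s"
  by (metis part_diff part_in_piece part_piece)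

lemma homogeneous_piece:
  assumes "homogeneous \<theta> a c" "p \<in> piece (t - a) (s - c)"
  shows "\<theta> * p \<in> piece t s"
proof -
  have "part t s (\<theta> * p) = \<theta> * p" using assms by (simp add: homogeneous_def part_piece)
  then show ?thesis using part_in_piece by metis
qed

text \<open>
  The map \<open>(q, y) \<mapsto> q + \<theta> y\<close> sends the right-hand product onto the piece of the larger ideal, and regularity makes
  each fibre a coset of the piece of \<open>Q\<close> in the lower degree. The bijection uses a section \<open>y\<close> of this map.
\<close>

lemma card_adjoin_piece:
  assumes Q: "graded_ideal Q" and \<theta>: "homogeneous \<theta> a c" "regular Q \<theta>"
  shows "card (adjoin Q \<theta> \<inter> piece t s) * card (Q \<inter> piece (t - a) (s - c))
       = card (Q \<inter> piece t s) * card (piece (t - a) (s - c))"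
proof -
  let ?Q' = "adjoin Q \<theta>" and ?P = "piece t s" and ?P' = "piece (t - a) (s - c)"
  have iQ: "is_ideal Q" using Q by (simp add: graded_ideal_def)
  have "\<exists>y\<in>?P'. p - \<theta> * y \<in> Q" if "p \<in> ?Q' \<inter> ?P" for p
  proof -
    from that obtain y where y: "p - y * \<theta> \<in> Q" by (auto simp: adjoin_iff)
    then have "part t s (p - \<theta> * y) \<in> Q" using Q by (auto simp: graded_ideal_def mult.commute)
    moreover have "part t s (p - \<theta> * y) = p - \<theta> * part (t - a) (s - c) y"
      using that \<theta>(1) by (simp add: part_diff part_piece homogeneous_def)
    ultimately show ?thesis using part_in_piece by metis
  qed
  then obtain y where y: "\<And>p. p \<in> ?Q' \<inter> ?P \<Longrightarrow> y p \<in> ?P' \<and> p - \<theta> * y p \<in> Q" by metis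
  define f where "f = (\<lambda>(p, z). (p - \<theta> * (y p + z), y p + z))"
  define f' where "f' = (\<lambda>(q, x). (q + \<theta> * x, x - y (q + \<theta> * x)))"
  have "bij_betw f ((?Q' \<inter> ?P) \<times> (Q \<inter> ?P')) ((Q \<inter> ?P) \<times> ?P')"
  proof (rule bij_betw_byWitness[where f' = f'])
    show "\<forall>x\<in>(?Q' \<inter> ?P) \<times> (Q \<inter> ?P'). f' (f x) = x"
      by (auto simp: f_def f'_def)
    show "\<forall>x\<in>(Q \<inter> ?P) \<times> ?P'. f (f' x) = x"
      by (auto simp: f_def f'_def)
    show "f ` ((?Q' \<inter> ?P) \<times> (Q \<inter> ?P')) \<subseteq> (Q \<inter> ?P) \<times> ?P'"
    proof (clarsimp simp: f_def)
      fix p z assume p: "p \<in> ?Q'" "p \<in> ?P" and z: "z \<in> Q" "z \<in> ?P'"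
      have yp: "y p \<in> ?P'" "p - \<theta> * y p \<in> Q" using y p by auto
      have "p - \<theta> * (y p + z) = (p - \<theta> * y p) - \<theta> * z" by (simp add: algebra_simps)
      also have "\<dots> \<in> Q" by (rule is_ideal_diff[OF iQ yp(2) is_ideal_mult[OF iQ z(1)]])
      finally show "p - \<theta> * (y p + z) \<in> Q \<and> p - \<theta> * (y p + z) \<in> ?P \<and> y p + z \<in> ?P'"
        using p z yp by (auto intro!: piece_diff piece_add homogeneous_piece[OF \<theta>(1)])
    qed
    show "f' ` ((Q \<inter> ?P) \<times> ?P') \<subseteq> (?Q' \<inter> ?P) \<times> (Q \<inter> ?P')"
    proof (clarsimp simp: f'_def)
      fix q x assume q: "q \<in> Q" "q \<in> ?P" and x: "x \<in> ?P'"
      define p where "p = q + \<theta> * x"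
      have p: "p \<in> ?Q'" "p \<in> ?P"
        using q x by (auto simp: p_def adjoin_iff mult.commute intro!: piece_add homogeneous_piece[OF \<theta>(1)] exI[of _ x])
      have yp: "y p \<in> ?P'" "p - \<theta> * y p \<in> Q" using y p by auto
      have "\<theta> * (x - y p) = (p - \<theta> * y p) - q" by (simp add: p_def algebra_simps)
      also have "\<dots> \<in> Q" by (rule is_ideal_diff[OF iQ yp(2) q(1)])
      finally have "x - y p \<in> Q" using \<theta>(2) by (blast intro: regularD)
      then show "q + \<theta> * x \<in> ?Q' \<and> q + \<theta> * x \<in> ?P \<and> x - y (q + \<theta> * x) \<in> Q \<and> x - y (q + \<theta> * x) \<in> ?P'"
        using p yp x by (auto simp: p_def intro!: piece_diff)
    qed
  qed
  from bij_betw_same_card[OF this] show ?thesis by (simp add: card_cartesian_product)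
qed

lemma hilbert_adjoin:
  assumes Q: "graded_ideal Q" and \<theta>: "homogeneous \<theta> a c" "regular Q \<theta>"
  shows "hilbert (adjoin Q \<theta>) t s = hilbert Q t s - hilbert Q (t - a) (s - c)"
proof -
  have iQ: "is_ideal Q" using Q by (simp add: graded_ideal_def)
  let ?A = "real (card (adjoin Q \<theta> \<inter> piece t s))" and ?B = "real (card (Q \<inter> piece (t - a) (s - c)))"
  let ?C = "real (card (Q \<inter> piece t s))" and ?D = "real (card (piece (t - a) (s - c)))"
  let ?P = "real (card (piece t s))"
  have pos: "?A > 0" "?B > 0" "?C > 0" "?D > 0" "?P > 0"
    using card_ideal_piece_pos[OF iQ] card_ideal_piece_pos[OF is_ideal_adjoin[OF iQ]]
    by (simp_all add: card_piece)
  have "?A * ?B = ?C * ?D"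
    using card_adjoin_piece[OF assms, of t s] by (metis of_nat_mult)
  then have "log 2 ?A + log 2 ?B = log 2 ?C + log 2 ?D"
    using pos by (metis log_mult less_numeral_extra(3))
  then show ?thesis using pos by (simp add: hilbert_def log_divide)
qed

end

section \<open>Counting monomials\<close>

lemma weighted_monomials_empty:
  "weighted_monomials {} xw uw t s = (if t = 0 \<and> s = 0 then {0} else {})"
  by (auto simp: weighted_monomials_def)

text \<open>
  A monomial either avoids \<open>v\<close> or is \<open>v\<close> times another monomial.
\<close>

lemma card_weighted_monomials_insert:
  assumes V: "finite V" "v \<notin> V" and pos: "\<And>u. u \<in> insert v V \<Longrightarrow> 0 < xw u + uw u"
  shows "card (weighted_monomials (insert v V) xw uw t s) = card (weighted_monomials V xw uw t s)
     + card (weighted_monomials (insert v V) xw uw (t - int (xw v)) (s - int (uw v)))"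
proof -
  interpret big: bigrading "insert v V" xw uw
    using assms by unfold_locales auto
  interpret small: bigrading V xw uw
    using assms by unfold_locales auto
  let ?S = "\<lambda>\<nu>. Poly_Mapping.single v 1 + \<nu>"
  let ?B = "big.monomials (t - int (xw v)) (s - int (uw v))"
  have "big.monomials t s = small.monomials t s \<union> ?S ` ?B"
  proof (intro equalityI subsetI)
    fix \<mu> assume \<mu>: "\<mu> \<in> big.monomials t s"
    show "\<mu> \<in> small.monomials t s \<union> ?S ` ?B"
    proof (cases "Poly_Mapping.lookup \<mu> v = 0")
      case True
      then have "Poly_Mapping.keys \<mu> \<subseteq> V"
        using \<mu> by (auto simp: weighted_monomials_def in_keys_iff)
      then show ?thesis using \<mu> True V by (auto simp: weighted_monomials_def)
    next
      case False
      then have "?S (\<mu> - Poly_Mapping.single v 1) = \<mu>"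
        by (intro poly_mapping_eqI) (auto simp: lookup_add lookup_minus lookup_single when_def)
      then show ?thesis using \<mu> big.monomials_shift[of v "\<mu> - Poly_Mapping.single v 1" t s]
        by (metis UnI2 imageI insertI1)
    qed
  next
    fix \<mu> assume "\<mu> \<in> small.monomials t s \<union> ?S ` ?B"
    then show "\<mu> \<in> big.monomials t s"
    proof
      assume \<mu>: "\<mu> \<in> small.monomials t s"
      then have "Poly_Mapping.lookup \<mu> v = 0"
        using V by (auto simp: weighted_monomials_def in_keys_iff)
      then show ?thesis using \<mu> V by (auto simp: weighted_monomials_def)
    qed (use big.monomials_shift[of v] in auto)
  qed
  moreover have "small.monomials t s \<inter> ?S ` ?B = {}"
  proof -
    have "Poly_Mapping.lookup \<mu> v = 0" if "\<mu> \<in> small.monomials t s" for \<mu>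
      using that V by (auto simp: weighted_monomials_def in_keys_iff)
    moreover have "Poly_Mapping.lookup \<mu> v \<noteq> 0" if "\<mu> \<in> ?S ` ?B" for \<mu>
      using that by (auto simp: lookup_add)
    ultimately show ?thesis by blast
  qed
  moreover have "inj_on ?S ?B" by (auto simp: inj_on_def)
  ultimately show ?thesis
    using small.finite_monomials big.finite_monomials by (simp add: card_Un_disjoint card_image)
qed

lemma card_weighted_monomials_linear:
  assumes "finite U" "\<And>v. v \<in> U \<Longrightarrow> xw v = 0 \<and> uw v = 1"
  shows "card (weighted_monomials U xw uw t s)
       = (if t = 0 \<and> 0 \<le> s then (nat s + card U - 1) choose nat s else 0)"
  using assms
proof (induction U arbitrary: t s rule: finite_induct)
  case empty
  have "(nat s - 1) choose nat s = 0" if "s > 0" using that by (intro binomial_eq_0) auto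
  then show ?case by (auto simp: weighted_monomials_empty)
next
  case (insert v U)
  have rec: "card (weighted_monomials (insert v U) xw uw t s)
      = card (weighted_monomials U xw uw t s) + card (weighted_monomials (insert v U) xw uw t (s - 1))"
    for t s
    using card_weighted_monomials_insert[of U v xw uw t s] insert by fastforce
  have IH: "card (weighted_monomials U xw uw t s)
       = (if t = 0 \<and> 0 \<le> s then (nat s + card U - 1) choose nat s else 0)" for t s
    using insert by blast
  have neg: "card (weighted_monomials (insert v U) xw uw t s) = 0" if "s < 0" for t s
  proof -
    have "weighted_monomials (insert v U) xw uw t s = {}"
      using that by (auto simp: weighted_monomials_def simp del: of_nat_sum of_nat_mult)
    then show ?thesis by simp
  qed
  have "card (weighted_monomials (insert v U) xw uw t (int n))
      = (if t = 0 then (n + card U) choose n else 0)" for n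
  proof (induction n)
    case 0
    then show ?case using rec[of t 0] neg[of "-1" t] by (simp add: IH)
  next
    case (Suc n)
    have "card (weighted_monomials (insert v U) xw uw t (int (Suc n) - 1))
      = (if t = 0 then (n + card U) choose n else 0)" using Suc by simp
    then show ?case using rec[of t "int (Suc n)"] by (simp add: IH del: of_nat_Suc)
  qed
  from this[of "nat s"] show ?case using neg insert.hyps by (cases "s < 0") auto
qed

text \<open>
  Coefficients extended by zero to negative indices, in line with the integer degrees of the Hilbert
  function.
\<close>

definition coef :: "real fps \<Rightarrow> int \<Rightarrow> real" where
  "coef F t = (if t < 0 then 0 else fps_nth F (nat t))"

lemma coef_one_minus_power: "coef ((1 - fps_X ^ a) * F) t = coef F t - coef F (t - int a)"
proof -
  have "(1 - fps_X ^ a) * F = F - fps_X ^ a * F" by (simp add: algebra_simps)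
  then show ?thesis by (auto simp: coef_def fps_X_power_mult_nth nat_diff_distrib)
qed

text \<open>
  The \<open>x\<close>-variables contribute the coefficients of their generating function, independently of the degree \<open>s\<close>
  in the coefficient variables.
\<close>

lemma card_weighted_monomials_mixed:
  assumes "finite X" "finite U" "X \<inter> U = {}"
    and "\<And>v. v \<in> X \<Longrightarrow> 0 < xw v \<and> uw v = 0" "\<And>v. v \<in> U \<Longrightarrow> xw v = 0 \<and> uw v = 1"
  shows "real (card (weighted_monomials (X \<union> U) xw uw t s))
       = coef (\<Prod>v\<in>X. inverse (1 - fps_X ^ xw v)) t * card (weighted_monomials U xw uw 0 s)"
  using assms
proof (induction X arbitrary: t rule: finite_induct)
  case empty
  then show ?case by (auto simp: card_weighted_monomials_linear coef_def)
next
  case (insert v X)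
  let ?F = "\<lambda>X. \<Prod>v\<in>X. inverse (1 - fps_X ^ xw v :: real fps)"
  let ?c = "real (card (weighted_monomials U xw uw 0 s))"
  have v: "0 < xw v" "uw v = 0" "v \<notin> X \<union> U" using insert by auto
  have IH: "real (card (weighted_monomials (X \<union> U) xw uw t s)) = coef (?F X) t * ?c" for t
    using insert by auto
  have rec: "card (weighted_monomials (insert v X \<union> U) xw uw t s)
      = card (weighted_monomials (X \<union> U) xw uw t s)
      + card (weighted_monomials (insert v X \<union> U) xw uw (t - int (xw v)) s)" for t
    using card_weighted_monomials_insert[of "X \<union> U" v xw uw t s] insert.prems insert.hyps v by fastforce
  have "(1 - fps_X ^ xw v) * inverse (1 - fps_X ^ xw v) = (1 :: real fps)"
    using v by (intro inverse_mult_eq_1') simp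
  then have "(1 - fps_X ^ xw v) * ?F (insert v X) = ?F X"
    using insert.hyps by (simp add: mult.assoc[symmetric])
  then have coef: "coef (?F (insert v X)) t = coef (?F X) t + coef (?F (insert v X)) (t - int (xw v))" for t
    using coef_one_minus_power[of "xw v" "?F (insert v X)" t] by simp
  have neg: "card (weighted_monomials (insert v X \<union> U) xw uw t s) = 0" if "t < 0" for t
  proof -
    have "weighted_monomials (insert v X \<union> U) xw uw t s = {}"
      using that by (auto simp: weighted_monomials_def simp del: of_nat_sum of_nat_mult)
    then show ?thesis by simp
  qed
  have "real (card (weighted_monomials (insert v X \<union> U) xw uw (int n) s)) = coef (?F (insert v X)) (int n) * ?c" for n
  proof (induction n rule: less_induct)
    case (less n)
    have "real (card (weighted_monomials (insert v X \<union> U) xw uw (int n - int (xw v)) s))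
        = coef (?F (insert v X)) (int n - int (xw v)) * ?c"
    proof (cases "n < xw v")
      case True
      then show ?thesis using neg[of "int n - int (xw v)"] by (simp add: coef_def)
    next
      case False
      then show ?thesis using less[of "n - xw v"] v(1) by (simp add: of_nat_diff)
    qed
    then show ?case
      using rec[of "int n"] coef[of "int n"] IH[of "int n"] by (simp add: distrib_right)
  qed
  from this[of "nat t"] show ?case
    using neg by (cases "t < 0") (auto simp: coef_def)
qed

text \<open>
  Shifting the degree in the coefficient variables by one is asymptotically invisible. For the limit
  process this is what turns a factor \<open>1 - w q^a\<close> of the bigraded series into \<open>1 - q^a\<close>.
\<close>

lemma multiset_ratio_tendsto:
  assumes "0 < N"
  shows "(\<lambda>s. real ((s + N - 1) choose s) / real ((Suc s + N - 1) choose Suc s)) \<longlonglongrightarrow> 1"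
proof -
  have "real ((s + N - 1) choose s) / real ((Suc s + N - 1) choose Suc s)
      = 1 - (real N - 1) / real (s + N)" for s
  proof -
    have "Suc s * ((s + N) choose Suc s) = (s + N) * ((s + N - 1) choose s)"
      by (rule binomial_absorption)
    then have "real (Suc s) * real ((s + N) choose Suc s) = real (s + N) * real ((s + N - 1) choose s)"
      by (metis of_nat_mult)
    moreover have "0 < (s + N) choose Suc s" using assms by (simp add: zero_less_binomial_iff)
    ultimately show ?thesis using assms by (simp add: field_simps)
  qed
  moreover have "(\<lambda>s. 1 - (real N - 1) / real (s + N)) \<longlonglongrightarrow> 1 - 0"
    by (intro tendsto_diff tendsto_const LIMSEQ_ignore_initial_segment[where f = "\<lambda>s. (real N - 1) / real s"]
        lim_const_over_n)
  ultimately show ?thesis by simp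
qed

section \<open>Non-negativity from Hall's condition\<close>

text \<open>
  For each \<open>i\<close> and each \<open>J\<close> such that \<open>a i\<close> is in the semigroup of \<open>J\<close>, one monomial of degree \<open>a i\<close> in the
  variables of \<open>J\<close> is chosen, and the \<open>i\<close>-th form is the generic combination of these monomials. By Hall's
  condition a set \<open>T\<close> of forms has a monomial on each coordinate subspace of codimension less than
  \<open>card T\<close>, so that these forms are a regular sequence.
\<close>

theorem hall_imp_nonneg:
  fixes a b :: "nat \<Rightarrow> nat"
  assumes a: "\<And>i. i < m \<Longrightarrow> 0 < a i" and b: "\<And>j. j < m \<Longrightarrow> 0 < b j"
    and hall: "\<And>J. J \<subseteq> {..<m} \<Longrightarrow> card J \<le> card {i. i < m \<and> (\<exists>\<alpha>. (\<Sum>j\<in>J. \<alpha> j * b j) = a i)}"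
  shows "0 \<le> fps_nth ((\<Prod>i<m. 1 - fps_X ^ a i) * (\<Prod>j<m. inverse (1 - fps_X ^ b j)) :: real fps) t"
proof (cases "m = 0")
  case True
  then show ?thesis by (cases t) simp_all
next
  case False
  define good where "good i J \<longleftrightarrow> (\<exists>\<alpha>. (\<Sum>j\<in>J. \<alpha> j * b j) = a i)" for i J
  define \<alpha> where "\<alpha> i J = (SOME \<alpha>. (\<Sum>j\<in>J. \<alpha> j * b j) = a i)" for i J
  have \<alpha>: "(\<Sum>j\<in>J. \<alpha> i J j * b j) = a i" if "good i J" for i J
    using that unfolding good_def \<alpha>_def by (rule someI_ex)
  define G where "G i = (\<lambda>J. \<Prod>j\<in>J. var (0, j) ^ \<alpha> i J j) ` {J. J \<subseteq> {..<m} \<and> good i J}" for i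
  have "finite (G i)" for i unfolding G_def by simp
  then have "\<forall>i. \<exists>l. set l = G i" by (simp add: finite_list)
  from choice[OF this] obtain gs where gs: "\<And>i. set (gs i) = G i" by blast
  have free: "free_of (n, j) g" if "g \<in> set (gs i)" "0 < n" for i n j g
    using that by (auto simp: gs G_def intro!: free_of_prod free_of_power free_of_var)
  have tame: "tame g" if "g \<in> set (gs i)" for i g
    using that by (auto simp: gs G_def intro!: tame_prod tame_power tame_var)
  have depth: "depth_ge (\<Union>i\<in>T. set (gs i)) (card T) {0}" if T: "T \<subseteq> {..<m}" for T
  proof -
    have fT: "finite T" using T by (rule finite_subset) simp
    have "depth_ge (\<Union>i\<in>T. set (gs i)) (card T) (x_ideal {})"
    proof (rule depth_ge_monomials[where V = "{..<m}"])
      fix J assume J: "J \<subseteq> {..<m} - {}" "card ({..<m} - {}) < card J + card T"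
      define I where "I = {i. i < m \<and> good i J}"
      have I: "finite I" "I \<subseteq> {..<m}" "card J \<le> card I"
        using hall[of J] J by (auto simp: I_def good_def)
      have "T \<inter> I \<noteq> {}"
      proof
        assume "T \<inter> I = {}"
        then have "card T + card I = card (T \<union> I)" using fT I by (simp add: card_Un_disjoint)
        also have "\<dots> \<le> card {..<m}" using T I by (intro card_mono) auto
        finally show False using J I by simp
      qed
      then obtain i where "i \<in> T" "good i J" by (auto simp: I_def)
      then have "(\<Prod>j\<in>J. var (0, j) ^ \<alpha> i J j) \<in> (\<Union>i\<in>T. set (gs i))"
        using J by (auto simp: gs G_def)
      then show "\<exists>\<alpha>. (\<Prod>j\<in>J. var (0, j) ^ \<alpha> j) \<in> (\<Union>i\<in>T. set (gs i))" by (intro exI[of _ "\<alpha> i J"])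
    qed (use fT tame in auto)
    then show ?thesis by (simp add: ideal_span_empty)
  qed
  have regular: "regular (generic_ideal gs i) (generic (Suc i) (gs i))" if "i < m" for i
    using that free depth by (intro generic_ideal_regular[of m]) auto

  \<comment> \<open>\<open>x j\<close> has bidegree \<open>(b j, 0)\<close> and every coefficient variable has bidegree \<open>(0, 1)\<close>, so that the
    \<open>i\<close>-th form has bidegree \<open>(a i, 1)\<close>\<close>
  define X where "X = (\<lambda>j. (0 :: nat, j)) ` {..<m}"
  define U where "U = (\<Union>i<m. (\<lambda>k. (Suc i, k)) ` {..<length (gs i)})"
  define xw :: "nat \<times> nat \<Rightarrow> nat" where "xw v = (if fst v = 0 then b (snd v) else 0)" for v
  define uw :: "nat \<times> nat \<Rightarrow> nat" where "uw v = (if fst v = 0 then 0 else 1)" for v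
  have XU: "finite X" "finite U" "X \<inter> U = {}"
    "\<And>v. v \<in> X \<Longrightarrow> 0 < xw v \<and> uw v = 0" "\<And>v. v \<in> U \<Longrightarrow> xw v = 0 \<and> uw v = 1"
    using b by (auto simp: X_def U_def xw_def uw_def)
  \<comment> \<open>without coefficient variables \<open>C s\<close> below would vanish for \<open>s > 0\<close>\<close>
  have "U \<noteq> {}"
  proof -
    have "card {..<m} \<le> card {i. i < m \<and> good i {..<m}}"
      using hall[of "{..<m}"] by (simp add: good_def)
    then have "{i. i < m \<and> good i {..<m}} \<noteq> {}" using False by force
    then obtain i where "i < m" "good i {..<m}" by auto
    then have "set (gs i) \<noteq> {}" by (auto simp: gs G_def)
    then have "(Suc i, 0) \<in> U" using \<open>i < m\<close> by (auto simp: U_def)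
    then show ?thesis by auto
  qed
  then have cU: "0 < card U" using XU by (simp add: card_gt_0_iff)
  interpret bigrading "X \<union> U" xw uw
    using XU by unfold_locales auto
  have hom: "homogeneous (generic (Suc i) (gs i)) (int (a i)) 1" if "i < m" for i
    unfolding generic_def
  proof (rule homogeneous_sum)
    fix k assume k: "k \<in> {..<length (gs i)}"
    then have "gs i ! k \<in> G i" using gs by (metis lessThan_iff nth_mem)
    then obtain J where J: "J \<subseteq> {..<m}" "good i J" "gs i ! k = (\<Prod>j\<in>J. var (0, j) ^ \<alpha> i J j)"
      by (auto simp: G_def)
    have "homogeneous (var (0, j)) (int (b j)) 0" if "j \<in> J" for j
      using homogeneous_var[of "(0, j)"] that J by (auto simp: X_def xw_def uw_def)
    then have "homogeneous (\<Prod>j\<in>J. var (0, j) ^ \<alpha> i J j)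
        (\<Sum>j\<in>J. int (\<alpha> i J j) * int (b j)) (\<Sum>j\<in>J. int (\<alpha> i J j) * 0)"
      by (intro homogeneous_prod homogeneous_power)
    also have "(\<Sum>j\<in>J. int (\<alpha> i J j) * int (b j)) = int (a i)"
      using \<alpha>[OF J(2)] by (metis (no_types, lifting) of_nat_mult of_nat_sum sum.cong)
    finally have "homogeneous (gs i ! k) (int (a i)) 0" using J by simp
    moreover have "homogeneous (var (Suc i, k)) 0 1"
      using homogeneous_var[of "(Suc i, k)"] k that by (auto simp: U_def xw_def uw_def)
    ultimately show "homogeneous (var (Suc i, k) * gs i ! k) (int (a i)) 1"
      using homogeneous_mult by fastforce
  qed
  have graded: "graded_ideal (generic_ideal gs i)" if "i \<le> m" for i
    using that
  proof (induction i)
    case (Suc i)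
    then show ?case using graded_ideal_adjoin[OF _ hom[of i]] by simp
  qed (simp add: graded_ideal_zero)

  define C where "C s = real (card (weighted_monomials U xw uw 0 (int s)))" for s
  have C: "C s = real ((s + card U - 1) choose s)" for s
    unfolding C_def using XU by (subst card_weighted_monomials_linear) auto
  have Cpos: "0 < C s" for s
    using cU by (simp add: C)
  have Cratio: "(\<lambda>s. C s / C (Suc s)) \<longlonglongrightarrow> 1"
    unfolding C using cU by (rule multiset_ratio_tendsto)
  \<comment> \<open>the series after the first \<open>i\<close> forms have been factored out; the limit below removes the
    coefficient variables from it\<close>
  define F where "F i = (\<Prod>i<i. 1 - fps_X ^ a i) * (\<Prod>j<m. inverse (1 - fps_X ^ b j) :: real fps)" for i
  have lim: "(\<lambda>s. hilbert (generic_ideal gs i) t (int s) / C s) \<longlonglongrightarrow> coef (F i) t" if "i \<le> m" for i t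
    using that
  proof (induction i arbitrary: t)
    case 0
    have "(\<Prod>v\<in>X. inverse (1 - fps_X ^ xw v) :: real fps) = (\<Prod>j<m. inverse (1 - fps_X ^ b j))"
      unfolding X_def by (subst prod.reindex) (auto simp: inj_on_def xw_def)
    then have "hilbert {0} t (int s) / C s = coef (F 0) t" for s
      using card_weighted_monomials_mixed[OF XU, where t = t and s = "int s"] Cpos[of s]
      by (simp add: hilbert_zero C_def F_def)
    then show ?case by simp
  next
    case (Suc i)
    let ?H = "hilbert (generic_ideal gs i)"
    have "(\<lambda>s. ?H (t - int (a i)) (int s) / C s * (C s / C (Suc s))) \<longlonglongrightarrow> coef (F i) (t - int (a i)) * 1"
      using Suc by (intro tendsto_mult Cratio Suc.IH) auto
    moreover have "?H (t - int (a i)) (int s) / C s * (C s / C (Suc s))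
        = ?H (t - int (a i)) (int (Suc s) - 1) / C (Suc s)" for s
      using Cpos[of s] by simp
    ultimately have "(\<lambda>s. ?H (t - int (a i)) (int s - 1) / C s) \<longlonglongrightarrow> coef (F i) (t - int (a i))"
      by (intro LIMSEQ_imp_Suc[where f = "\<lambda>s. ?H (t - int (a i)) (int s - 1) / C s"]) (simp only: mult_1_right)
    then have "(\<lambda>s. ?H t (int s) / C s - ?H (t - int (a i)) (int s - 1) / C s)
        \<longlonglongrightarrow> coef (F i) t - coef (F i) (t - int (a i))"
      using Suc by (intro tendsto_diff Suc.IH) auto
    moreover have "F (Suc i) = (1 - fps_X ^ a i) * F i"
      by (simp add: F_def ac_simps)
    moreover have "hilbert (generic_ideal gs (Suc i)) t s = ?H t s - ?H (t - int (a i)) (s - 1)" for s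
      using hilbert_adjoin[OF graded hom regular, of i t s] Suc.prems by simp
    ultimately show ?case by (simp add: coef_one_minus_power diff_divide_distrib)
  qed
  have "0 \<le> coef (F m) (int t)"
  proof (rule LIMSEQ_le_const[OF lim[of m "int t"]])
    show "\<exists>N. \<forall>s\<ge>N. 0 \<le> hilbert (generic_ideal gs m) (int t) (int s) / C s"
      using hilbert_nonneg[of "generic_ideal gs m"] graded[of m] Cpos
      by (auto simp: graded_ideal_def less_imp_le)
  qed simp
  then show ?thesis by (simp add: coef_def F_def)
qed

section \<open>Numerical semigroups\<close>

text \<open>
  The ideal \<open>R\<close> of the integers is given by its closure properties, because in the application it consists of
  the integers that are congruent to a sum of generators modulo a fixed number.
\<close>

lemma Gcd_in_int_ideal:
  fixes b :: "'i \<Rightarrow> nat"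
  assumes "finite J" and zero: "0 \<in> R"
    and add: "\<And>x y :: int. x \<in> R \<Longrightarrow> y \<in> R \<Longrightarrow> x + y \<in> R"
    and mult: "\<And>c x. x \<in> R \<Longrightarrow> c * x \<in> R"
    and b: "\<And>j. j \<in> J \<Longrightarrow> int (b j) \<in> R"
  shows "int (Gcd (b ` J)) \<in> R"
  using assms(1) b
proof (induction J rule: finite_induct)
  case empty
  then show ?case using zero by simp
next
  case (insert j J)
  obtain u v where "u * int (b j) + v * int (Gcd (b ` J)) = gcd (int (b j)) (int (Gcd (b ` J)))"
    using bezout_int by blast
  moreover have "u * int (b j) + v * int (Gcd (b ` J)) \<in> R"
    using insert by (intro add mult) auto
  ultimately show ?case by (simp add: gcd_int_int_eq)
qed

text \<open>
  Schur's bound for the Frobenius number, with \<open>N = b j\<^sub>0\<close> and no generator larger than \<open>K\<close>. Every multiple of the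
  greatest common divisor is congruent modulo \<open>N\<close> to a sum of generators. A shortest such sum has fewer than
  \<open>N\<close> terms, since otherwise two partial sums agree modulo \<open>N\<close> and the segment between them can be left
  out. It is therefore at most \<open>(N - 1) K\<close>, hence at most \<open>x\<close> because it is congruent to \<open>x\<close>, and copies of
  \<open>N\<close> fill the gap.
\<close>

lemma semigroup_membership:
  fixes b :: "'i \<Rightarrow> nat"
  assumes J: "finite J" "j\<^sub>0 \<in> J" and pos: "0 < b j\<^sub>0" and K: "\<And>j. j \<in> J \<Longrightarrow> b j \<le> K"
    and dvd: "Gcd (b ` J) dvd x" and large: "(b j\<^sub>0 - 1) * (K - 1) \<le> x"
  shows "\<exists>\<alpha>. (\<Sum>j\<in>J. \<alpha> j * b j) = x"
proof -
  define N where "N = b j\<^sub>0"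
  have N: "0 < N" using pos by (simp add: N_def)
  define S where "S xs = sum_list (map b xs)" for xs
  define R where "R = {y. \<exists>xs. set xs \<subseteq> J \<and> [int (S xs) = y] (mod int N)}"
  have zero: "0 \<in> R" unfolding R_def by (auto intro!: exI[of _ "[]"] simp: S_def)
  have add: "y + z \<in> R" if yz: "y \<in> R" "z \<in> R" for y z
  proof -
    from yz obtain xs ys where "set xs \<subseteq> J" "set ys \<subseteq> J"
      "[int (S xs) = y] (mod int N)" "[int (S ys) = z] (mod int N)" by (auto simp: R_def)
    then have "set (xs @ ys) \<subseteq> J" "[int (S (xs @ ys)) = y + z] (mod int N)"
      by (auto simp: S_def intro: cong_add)
    then show ?thesis unfolding R_def by blast
  qed
  \<comment> \<open>only sums with non-negative multiplicities are allowed, but modulo \<open>N\<close> every integer factor is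
    congruent to such a multiplicity\<close>
  have cong: "z \<in> R" if "y \<in> R" "[y = z] (mod int N)" for y z
    using that by (auto simp: R_def intro: cong_trans)
  have nat_mult: "int c * y \<in> R" if "y \<in> R" for c y
    by (induction c) (auto simp: zero distrib_right intro: add that)
  have mult: "c * y \<in> R" if "y \<in> R" for c y
  proof (rule cong)
    show "int (nat (c mod int N)) * y \<in> R" by (rule nat_mult[OF that])
    show "[int (nat (c mod int N)) * y = c * y] (mod int N)"
      using N by (intro cong_mult) auto
  qed
  have "int (b j) \<in> R" if "j \<in> J" for j
    using that unfolding R_def by (auto intro!: exI[of _ "[j]"] simp: S_def)
  then have "int (Gcd (b ` J)) \<in> R"
    by (intro Gcd_in_int_ideal[OF J(1) zero add mult])
  moreover obtain c where "x = c * Gcd (b ` J)" using dvd by (auto simp: dvd_def mult.commute)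
  ultimately have "int x \<in> R" using mult[of "int (Gcd (b ` J))" "int c"] by simp
  then have ex: "\<exists>xs. set xs \<subseteq> J \<and> [S xs = x] (mod N)"
    by (auto simp: R_def cong_int_iff)
  define P where "P xs \<longleftrightarrow> set xs \<subseteq> J \<and> [S xs = x] (mod N)" for xs
  obtain xs where xs: "P xs" and minimal: "\<And>ys. P ys \<Longrightarrow> length xs \<le> length ys"
    using ex_has_least_nat[of P _ length] ex unfolding P_def[symmetric] by blast
  have "length xs < N"
  proof (rule ccontr)
    assume "\<not> length xs < N"
    have "\<not> inj_on (\<lambda>i. S (take i xs) mod N) {..length xs}"
    proof
      assume "inj_on (\<lambda>i. S (take i xs) mod N) {..length xs}"
      then have "card {..length xs} \<le> card {..<N}"
        using N by (intro card_inj_on_le[where f = "\<lambda>i. S (take i xs) mod N"]) auto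
      then show False using \<open>\<not> length xs < N\<close> by simp
    qed
    then obtain i j where ij: "i < j" "j \<le> length xs" "[S (take i xs) = S (take j xs)] (mod N)"
      unfolding inj_on_def cong_def by (metis atMost_iff nat_neq_iff)
    have "S (take i xs @ drop j xs) = S (take i xs) + S (drop j xs)" by (simp add: S_def)
    moreover have "S xs = S (take j xs) + S (drop j xs)"
      unfolding S_def by (metis append_take_drop_id map_append sum_list_append)
    ultimately have "[S (take i xs @ drop j xs) = S xs] (mod N)"
      using ij(3) by (auto intro: cong_add)
    then have "P (take i xs @ drop j xs)"
      using xs unfolding P_def by (auto dest: in_set_takeD in_set_dropD intro: cong_trans)
    from minimal[OF this] show False using ij by simp
  qed
  have "S ys \<le> length ys * K" if "set ys \<subseteq> J" for ys
    using that by (induction ys) (auto simp: S_def K add_mono)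
  then have "S xs \<le> length xs * K" using xs by (simp add: P_def)
  also have "\<dots> \<le> (N - 1) * K" using \<open>length xs < N\<close> by (intro mult_right_mono) auto
  finally have Sle: "S xs \<le> (N - 1) * K" .
  have "S xs \<le> x"
  proof (rule ccontr)
    assume less: "\<not> S xs \<le> x"
    then have "N dvd S xs - x"
      using xs unfolding P_def by (metis cong_altdef_nat nat_le_linear)
    then have "N \<le> S xs - x" using less by (intro dvd_imp_le) auto
    then have "x + N \<le> (N - 1) * K" using Sle less by linarith
    moreover have "(N - 1) * K \<le> (N - 1) * (K - 1) + (N - 1)"
      by (cases K) (auto simp: algebra_simps)
    ultimately show False using large N by (auto simp: N_def)
  qed
  then have "N dvd x - S xs"
    using xs unfolding P_def by (metis cong_altdef_nat cong_sym)
  then obtain q where q: "x - S xs = N * q" by (auto simp: dvd_def)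
  define ys where "ys = xs @ replicate q j\<^sub>0"
  have "set ys \<subseteq> J" using xs J by (auto simp: ys_def P_def)
  have "S ys = x" using q \<open>S xs \<le> x\<close> by (simp add: ys_def S_def N_def sum_list_replicate mult.commute)
  moreover have "S ys = (\<Sum>j\<in>J. count_list ys j * b j)"
    unfolding S_def using J \<open>set ys \<subseteq> J\<close> by (intro sum_list_map_eq_sum_count2)
  ultimately show ?thesis by auto
qed

text \<open>
  For a single generator divisibility is enough. Otherwise the least generator is at most \<open>k - 1\<close>, and Schur's
  bound with largest generator \<open>k\<close> is \<open>(k - 2) (k - 1)\<close>.
\<close>

lemma interval_semigroup:
  fixes k l x :: nat
  assumes J: "J \<subseteq> {..<k - l}" "J \<noteq> {}" and large: "(k - 2) * (k - 1) \<le> x"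
    and dvd: "Gcd ((\<lambda>j. l + 1 + j) ` J) dvd x"
  shows "\<exists>\<alpha>. (\<Sum>j\<in>J. \<alpha> j * (l + 1 + j)) = x"
proof -
  have fin: "finite J" using J(1) by (rule finite_subset) simp
  define i where "i = Min J"
  have i: "i \<in> J" "\<And>j. j \<in> J \<Longrightarrow> i \<le> j" using fin J by (auto simp: i_def)
  show ?thesis
  proof (cases "J = {i}")
    case True
    then obtain q where "x = (l + 1 + i) * q" using dvd by (auto simp: dvd_def)
    then show ?thesis using True by (intro exI[of _ "\<lambda>_. q"]) (simp add: mult.commute)
  next
    case False
    then obtain j where "j \<in> J" "j \<noteq> i" using i by auto
    then have "i < j" "j < k - l" using i(2)[of j] J by auto
    then have "(l + 1 + i - 1) * (k - 1) \<le> (k - 2) * (k - 1)" by (intro mult_right_mono) auto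
    then have "(l + 1 + i - 1) * (k - 1) \<le> x" using large by (rule order_trans)
    then show ?thesis
      using fin i J dvd by (intro semigroup_membership[where K = k]) auto
  qed
qed

section \<open>Multiplicities of roots of unity\<close>

lemma cis_root_of_unity:
  assumes "0 < d"
  shows "cis (2 * pi / real d) ^ a = 1 \<longleftrightarrow> d dvd a"
proof
  assume "d dvd a"
  then obtain q where "a = d * q" by (auto simp: dvd_def)
  then have "real a * (2 * pi / real d) = 2 * pi * real q" using assms by simp
  then show "cis (2 * pi / real d) ^ a = 1" by (simp add: DeMoivre)
next
  assume "cis (2 * pi / real d) ^ a = 1"
  then have "cos (real a * (2 * pi / real d)) = 1" by (simp add: DeMoivre complex_eq_iff)
  then obtain n :: int where "real a * (2 * pi / real d) = n * 2 * pi"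
    using cos_one_2pi_int[of "real a * (2 * pi / real d)"] by auto
  then have "real a = n * real d" using assms by (simp add: field_simps)
  then have "int a = n * int d" by (metis of_int_eq_iff of_int_mult of_int_of_nat_eq)
  then show "d dvd a" by (metis dvd_triv_right int_dvd_int_iff)
qed

lemma one_minus_monom_nonzero:
  assumes "0 < c"
  shows "1 - monom 1 c \<noteq> (0 :: 'a::comm_ring_1 poly)"
proof
  assume "1 - monom 1 c = (0 :: 'a poly)"
  then have "poly (1 - monom 1 c) 0 = (0 :: 'a)" by (simp only: poly_0)
  then show False using assms by (simp add: poly_monom power_0_left)
qed

lemma order_one_minus_power:
  fixes \<zeta> :: complex
  assumes "0 < a"
  shows "order \<zeta> (1 - monom 1 a) = (if \<zeta> ^ a = 1 then 1 else 0)"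
proof (cases "\<zeta> ^ a = 1")
  case True
  have nz: "1 - monom 1 a \<noteq> (0 :: complex poly)" using assms by (rule one_minus_monom_nonzero)
  have d: "pderiv (1 - monom 1 a) = (- monom (of_nat a) (a - 1) :: complex poly)"
    by (simp add: pderiv_diff pderiv_monom)
  have "\<zeta> \<noteq> 0" using True assms by (auto simp: power_0_left)
  then have "poly (pderiv (1 - monom 1 a)) \<zeta> \<noteq> 0" unfolding d using assms by (simp add: poly_monom)
  then have o0: "order \<zeta> (pderiv (1 - monom 1 a)) = 0"
    by (rule order_0I)
  have "poly (1 - monom 1 a) \<zeta> = 0" using True by (simp add: poly_monom)
  from order_pderiv[OF nz this] show ?thesis using o0 True by simp
next
  case False
  then show ?thesis by (simp add: order_0I poly_monom)
qed

lemma order_prod: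
  fixes f :: "'i \<Rightarrow> complex poly"
  assumes "\<And>i. i \<in> I \<Longrightarrow> f i \<noteq> 0"
  shows "order z (prod f I) = (\<Sum>i\<in>I. order z (f i))"
  using assms
proof (induction I rule: infinite_finite_induct)
  case (insert i I)
  then show ?case by (simp add: order_mult)
qed (auto simp: order_0I)

lemma card_multiples_le:
  fixes a b :: "nat \<Rightarrow> nat" and p :: "complex poly"
  assumes a: "\<And>i. i < m \<Longrightarrow> 0 < a i" and b: "\<And>j. j < m \<Longrightarrow> 0 < b j" and d: "0 < d"
    and eq: "p * (\<Prod>j<m. 1 - monom 1 (b j)) = (\<Prod>i<m. 1 - monom 1 (a i))"
  shows "card {j. j < m \<and> d dvd b j} \<le> card {i. i < m \<and> d dvd a i}"
proof -
  define \<zeta> where "\<zeta> = cis (2 * pi / real d)"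
  note nz = one_minus_monom_nonzero[where 'a = complex]
  have ord: "order \<zeta> (\<Prod>j<m. 1 - monom 1 (c j)) = card {j. j < m \<and> d dvd c j}"
    if "\<And>j. j < m \<Longrightarrow> 0 < c j" for c
  proof -
    have "order \<zeta> (\<Prod>j<m. 1 - monom 1 (c j)) = (\<Sum>j<m. if d dvd c j then 1 else 0)"
      using that nz by (subst order_prod)
        (auto simp: order_one_minus_power \<zeta>_def cis_root_of_unity[OF d] intro!: sum.cong)
    also have "\<dots> = card ({..<m} \<inter> {j. d dvd c j})"
      by (simp add: sum.If_cases)
    also have "{..<m} \<inter> {j. d dvd c j} = {j. j < m \<and> d dvd c j}" by auto
    finally show ?thesis .
  qed
  have nz': "(\<Prod>i<m. 1 - monom 1 (a i)) \<noteq> (0 :: complex poly)" using a nz by simp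
  have "order \<zeta> (\<Prod>i<m. 1 - monom 1 (a i)) = order \<zeta> p + order \<zeta> (\<Prod>j<m. 1 - monom 1 (b j))"
    unfolding eq[symmetric] using nz' eq by (intro order_mult) auto
  then show ?thesis using ord[of a] ord[of b] a b by simp
qed

section \<open>Integrality of the quotient\<close>

definition geometric :: "nat \<Rightarrow> 'r::comm_ring_1 fps" where
  "geometric b = Abs_fps (\<lambda>n. if b dvd n then 1 else 0)"

lemma geometric_inverse:
  assumes "0 < b"
  shows "(1 - fps_X ^ b) * geometric b = 1"
proof (rule fps_ext)
  fix n
  have "(1 - fps_X ^ b) * geometric b = geometric b - fps_X ^ b * (geometric b :: 'a fps)"
    by (simp add: algebra_simps)
  then show "fps_nth ((1 - fps_X ^ b) * geometric b) n = fps_nth (1 :: 'a fps) n"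
    using assms by (auto simp: geometric_def fps_X_power_mult_nth dvd_minus_self nat_dvd_not_less)
qed

text \<open>
  The power series expansion of the quotient makes sense over every ring. It thereby transports the quotient
  between the given field, the integers, the complex numbers (for roots of unity) and the reals (for
  non-negativity).
\<close>

definition quotient_series :: "nat \<Rightarrow> (nat \<Rightarrow> nat) \<Rightarrow> (nat \<Rightarrow> nat) \<Rightarrow> 'r::comm_ring_1 fps" where
  "quotient_series m a b = (\<Prod>i<m. 1 - fps_X ^ a i) * (\<Prod>j<m. geometric (b j))"

lemma quotient_series_of_int:
  "fps_nth (quotient_series m a b) n = of_int (fps_nth (quotient_series m a b) n)"
proof -
  define rel where "rel F G \<longleftrightarrow> (\<forall>n. fps_nth F n = of_int (fps_nth G n))"
    for F :: "'a fps" and G :: "int fps"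
  have mult: "rel (F * F') (G * G')" if "rel F G" "rel F' G'" for F F' G G'
    using that by (simp add: rel_def fps_mult_nth)
  have prod: "rel (prod F I) (prod G I)" if "\<And>i. i \<in> I \<Longrightarrow> rel (F i) (G i)" for F G and I :: "nat set"
    using that
  proof (induction I rule: infinite_finite_induct)
    case (insert i I)
    then show ?case by (simp add: mult)
  qed (auto simp: rel_def)
  have "rel (quotient_series m a b) (quotient_series m a b)"
    unfolding quotient_series_def
    by (intro mult prod) (auto simp: rel_def geometric_def)
  then show ?thesis by (simp add: rel_def)
qed

lemma prod_geometric_inverse:
  assumes "\<And>j. j < m \<Longrightarrow> 0 < b j"
  shows "(\<Prod>j<m. 1 - fps_X ^ b j) * (\<Prod>j<m. geometric (b j)) = (1 :: 'r::comm_ring_1 fps)"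
  unfolding prod.distrib[symmetric] using assms by (simp add: geometric_inverse)

lemma quotient_series_unique:
  fixes F :: "'r::comm_ring_1 fps"
  assumes "\<And>j. j < m \<Longrightarrow> 0 < b j"
    and "F * (\<Prod>j<m. 1 - fps_X ^ b j) = (\<Prod>i<m. 1 - fps_X ^ a i)"
  shows "F = quotient_series m a b"
proof -
  have "quotient_series m a b = F * ((\<Prod>j<m. 1 - fps_X ^ b j) * (\<Prod>j<m. geometric (b j)))"
    unfolding quotient_series_def assms(2)[symmetric] by (simp add: mult.assoc)
  then show ?thesis using prod_geometric_inverse[of m b, where 'r = 'r] assms(1) by simp
qed

lemma quotient_series_mult:
  assumes "\<And>j. j < m \<Longrightarrow> 0 < b j"
  shows "quotient_series m a b * (\<Prod>j<m. 1 - fps_X ^ b j) = (\<Prod>i<m. 1 - fps_X ^ a i :: 'r::comm_ring_1 fps)"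
  unfolding quotient_series_def mult.assoc mult.commute[of "\<Prod>j<m. geometric (b j)"]
  using prod_geometric_inverse[of m b, where 'r = 'r] assms by simp

lemma fps_of_poly_prod_one_minus:
  "fps_of_poly (\<Prod>i<m. 1 - monom 1 (c i)) = (\<Prod>i<m. 1 - fps_X ^ c i :: 'r::idom fps)"
  by (simp add: fps_of_poly_prod fps_of_poly_diff fps_of_poly_monom')

text \<open>
  The coefficients of \<open>p\<close> are integers because the denominator has constant term 1. A polynomial with the same
  integer coefficients over the complex numbers gives the divisor counts, which together with the semigroup
  assumption amount to Hall's condition.
\<close>

lemma quotient_series_nonneg:
  fixes p :: "'a::field_char_0 poly" and a b :: "nat \<Rightarrow> nat"
  assumes a: "\<And>i. i < m \<Longrightarrow> 0 < a i" and b: "\<And>j. j < m \<Longrightarrow> 0 < b j"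
    and eq: "p * (\<Prod>j<m. 1 - monom 1 (b j)) = (\<Prod>i<m. 1 - monom 1 (a i))"
    and semigroup: "\<And>J i. J \<subseteq> {..<m} \<Longrightarrow> J \<noteq> {} \<Longrightarrow> i < m \<Longrightarrow> Gcd (b ` J) dvd a i
           \<Longrightarrow> \<exists>\<alpha>. (\<Sum>j\<in>J. \<alpha> j * b j) = a i"
  shows "coeff p t \<in> \<nat>"
proof -
  define z :: "nat \<Rightarrow> int" where "z = fps_nth (quotient_series m a b)"
  have "fps_of_poly p * (\<Prod>j<m. 1 - fps_X ^ b j) = (\<Prod>i<m. 1 - fps_X ^ a i)"
    unfolding fps_of_poly_prod_one_minus[symmetric] fps_of_poly_mult[symmetric] eq ..
  then have "fps_of_poly p = quotient_series m a b"
    using b by (intro quotient_series_unique)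
  then have p: "coeff p n = of_int (z n)" for n
    unfolding z_def by (metis fps_of_poly_nth quotient_series_of_int)
  \<comment> \<open>the given field may lack roots of unity, whence the copy of \<open>p\<close> over the complex numbers\<close>
  define pc :: "complex poly" where "pc = Poly (map (\<lambda>n. of_int (z n)) [0..<Suc (degree p)])"
  have "z n = 0" if "n > degree p" for n
    using p[of n] that by (simp add: coeff_eq_0)
  then have "coeff pc n = of_int (z n)" for n
    by (cases "n \<le> degree p")
      (auto simp: pc_def nth_default_def not_le simp del: upt_Suc)
  then have "fps_of_poly pc = quotient_series m a b"
    unfolding z_def by (intro fps_ext) (metis fps_of_poly_nth quotient_series_of_int)
  then have "fps_of_poly (pc * (\<Prod>j<m. 1 - monom 1 (b j))) = fps_of_poly (\<Prod>i<m. 1 - monom 1 (a i))"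
    using b by (simp add: fps_of_poly_mult fps_of_poly_prod_one_minus quotient_series_mult)
  then have eqc: "pc * (\<Prod>j<m. 1 - monom 1 (b j)) = (\<Prod>i<m. 1 - monom 1 (a i))"
    by (simp only: fps_of_poly_eq_iff)
  have "0 \<le> fps_nth ((\<Prod>i<m. 1 - fps_X ^ a i) * (\<Prod>j<m. inverse (1 - fps_X ^ b j)) :: real fps) t"
  proof (rule hall_imp_nonneg)
    fix J assume J: "J \<subseteq> {..<m}"
    show "card J \<le> card {i. i < m \<and> (\<exists>\<alpha>. (\<Sum>j\<in>J. \<alpha> j * b j) = a i)}"
    proof (cases "J = {}")
      case False
      define d where "d = Gcd (b ` J)"
      obtain j where "j \<in> J" "0 < b j" using False J b by blast
      then have "0 < d" by (force simp: d_def intro!: Nat.gr0I)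
      have "card J \<le> card {j. j < m \<and> d dvd b j}"
        using J by (intro card_mono) (auto simp: d_def)
      also have "\<dots> \<le> card {i. i < m \<and> d dvd a i}"
        using a b \<open>0 < d\<close> eqc by (rule card_multiples_le)
      also have "\<dots> \<le> card {i. i < m \<and> (\<exists>\<alpha>. (\<Sum>j\<in>J. \<alpha> j * b j) = a i)}"
        using semigroup[OF J False] by (intro card_mono) (auto simp: d_def)
      finally show ?thesis .
    qed simp
  qed (use a b in auto)
  moreover have "inverse (1 - fps_X ^ b j) = (geometric (b j) :: real fps)" if "j < m" for j
    using geometric_inverse[OF b[OF that], where 'a = real] by (rule fps_inverse_unique)
  then have "(\<Prod>i<m. 1 - fps_X ^ a i) * (\<Prod>j<m. inverse (1 - fps_X ^ b j))
      = (quotient_series m a b :: real fps)"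
    by (simp add: quotient_series_def)
  ultimately have "0 \<le> (of_int (z t) :: real)"
    unfolding z_def using quotient_series_of_int[of m a b t, where 'a = real] by simp
  then have "0 \<le> z t" by simp
  then have "coeff p t = of_nat (nat (z t))" by (simp add: p)
  then show ?thesis by simp
qed

section \<open>Quotients of q-binomial coefficients\<close>

lemma one_minus_qvar_power: "1 - qvar ^ i = to_fract (1 - monom 1 i)"
proof -
  have "qvar ^ i = to_fract (monom 1 i)"
    by (induction i) (simp_all add: qvar_def monom_Suc mult.commute flip: to_fract_mult)
  then show ?thesis by simp
qed

lemma prod_one_minus_qvar:
  "(\<Prod>i=c + 1..c + m. 1 - qvar ^ i) = to_fract (\<Prod>i<m. 1 - monom 1 (c + 1 + i))"
proof (induction m)
  case (Suc m)
  then show ?case by (simp add: one_minus_qvar_power)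
qed simp

lemma prod_one_minus_split:
  "(\<Prod>i=1..c + m. 1 - qvar ^ i) = (\<Prod>i=1..c. 1 - qvar ^ i) * (\<Prod>i=c + 1..c + m. 1 - qvar ^ i)"
proof (induction m)
  case (Suc m)
  then show ?case by (simp add: mult.assoc)
qed simp

lemma prod_one_minus_qvar_nonzero: "(\<Prod>i=1..c. 1 - qvar ^ i) \<noteq> (0 :: 'a::field_char_0 poly fract)"
proof -
  have "1 - qvar ^ i \<noteq> (0 :: 'a poly fract)" if "1 \<le> i" for i
    unfolding one_minus_qvar_power to_fract_eq_0_iff using that by (intro one_minus_monom_nonzero) simp
  then show ?thesis by auto
qed

lemma qbinom_quotient:
  assumes "l < k" "k \<le> n"
  shows "qbinom n k / qbinom n l * to_fract (\<Prod>j<k - l. 1 - monom 1 (l + 1 + j))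
    = (to_fract (\<Prod>i<k - l. 1 - monom 1 (n - k + 1 + i)) :: 'a::field_char_0 poly fract)"
proof -
  let ?P = "\<lambda>c. \<Prod>i=1..c. 1 - qvar ^ i :: 'a poly fract"
  let ?B = "to_fract (\<Prod>j<k - l. 1 - monom 1 (l + 1 + j)) :: 'a poly fract"
  let ?A = "to_fract (\<Prod>i<k - l. 1 - monom 1 (n - k + 1 + i)) :: 'a poly fract"
  have k: "?P k = ?P l * ?B"
    using prod_one_minus_split[of l "k - l", where 'a = 'a] prod_one_minus_qvar[of l "k - l", where 'a = 'a] assms by simp
  have n: "?P (n - l) = ?P (n - k) * ?A"
    using prod_one_minus_split[of "n - k" "k - l", where 'a = 'a] prod_one_minus_qvar[of "n - k" "k - l", where 'a = 'a] assms by simp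
  note nz = prod_one_minus_qvar_nonzero[where 'a = 'a]
  have "?B \<noteq> 0" using k nz[of k] by auto
  then show ?thesis
    unfolding qbinom_def k n using nz[of l] nz[of n] nz[of "n - k"] nz[of "n - l"]
    by (simp add: field_simps)
qed

lemma qbinom_quotient_nonneg:
  assumes kl: "l < k" "2 * k \<le> n" and large: "(k - 2) * (k - 1) \<le> n - k + 1"
  shows "nonneg_if_polynomial (qbinom n k / qbinom n l :: 'a::field_char_0 poly fract)"
  unfolding nonneg_if_polynomial_def
proof (intro allI impI)
  fix p :: "'a poly" and t
  assume p: "qbinom n k / qbinom n l = to_fract p"
  have "to_fract (p * (\<Prod>j<k - l. 1 - monom 1 (l + 1 + j)))
      = to_fract (\<Prod>i<k - l. 1 - monom 1 (n - k + 1 + i))"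
    using qbinom_quotient[of l k n, where 'a = 'a] kl by (simp add: p)
  then have eq: "p * (\<Prod>j<k - l. 1 - monom 1 (l + 1 + j)) = (\<Prod>i<k - l. 1 - monom 1 (n - k + 1 + i))"
    by (simp only: to_fract_eq_iff)
  show "coeff p t \<in> \<nat>"
  proof (rule quotient_series_nonneg[OF _ _ eq])
    show "\<exists>\<alpha>. (\<Sum>j\<in>J. \<alpha> j * (l + 1 + j)) = n - k + 1 + i"
      if "J \<subseteq> {..<k - l}" "J \<noteq> {}" "Gcd ((\<lambda>j. l + 1 + j) ` J) dvd n - k + 1 + i" for J i
      using that large by (intro interval_semigroup) auto
  qed auto
qed

text \<open>
  For \<open>c = k - 1\<close> the number \<open>2 * (c div 2)\<close> is at least \<open>c - 1\<close>, with equality for even \<open>k\<close>. In this case, for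
  \<open>l = k - 1\<close> and the least admissible \<open>n\<close>, the two sides of the conclusion differ by one only.
\<close>

lemma threshold_large:
  fixes n k l :: nat
  assumes "l < k" "2 * k \<le> n" "2 * k * ((k - 1) div 2) + (k - l) < n"
  shows "(k - 2) * (k - 1) \<le> n - k + 1"
proof -
  obtain c where c: "k = c + 1" using assms by (cases k) auto
  have "c \<le> 2 * ((k - 1) div 2) + 1" by (simp add: c)
  then have "k * (c - 1) \<le> k * (2 * ((k - 1) div 2))" by (intro mult_left_mono) auto
  moreover have "k * (2 * ((k - 1) div 2)) = 2 * k * ((k - 1) div 2)" by simp
  ultimately have "k * (c - 1) + 1 < n" using assms(1,3) by linarith
  moreover have "(k - 2) * (k - 1) + c \<le> k * (c - 1) + 1"
    by (cases c) (auto simp: c algebra_simps)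
  ultimately show ?thesis using c by linarith
qed

theorem corollary1p7:
  shows "(\<forall>n k l :: nat. 1 \<le> l \<and> l < k \<and> 2 * k \<le> n \<and> 2 * k * ((k - 1) div 2) + (k - l) < n \<longrightarrow>
            nonneg_if_polynomial (qbinom n k / qbinom n l :: 'a::field_char_0 poly fract))
       \<and> (\<forall>n k l :: nat. 1 \<le> l \<and> l < k \<and> 2 * k \<le> n \<and> k ^ 2 \<le> n \<longrightarrow>
            nonneg_if_polynomial (qbinom n k / qbinom n l :: 'a poly fract))
       \<and> (\<forall>k :: nat. finite {(l, n). 1 \<le> l \<and> l < k \<and> 2 * k \<le> n \<and>
            \<not> nonneg_if_polynomial (qbinom n k / qbinom n l :: 'a poly fract)})"
proof -
  have 1: "nonneg_if_polynomial (qbinom n k / qbinom n l :: 'a poly fract)"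
    if "1 \<le> l" "l < k" "2 * k \<le> n" "2 * k * ((k - 1) div 2) + (k - l) < n" for n k l
    using that by (intro qbinom_quotient_nonneg threshold_large)
  have 2: "nonneg_if_polynomial (qbinom n k / qbinom n l :: 'a poly fract)"
    if "1 \<le> l" "l < k" "2 * k \<le> n" "k ^ 2 \<le> n" for n k l
  proof (rule 1)
    have "2 * k * ((k - 1) div 2) \<le> k * (k - 1)"
      using mult_left_mono[of "2 * ((k - 1) div 2)" "k - 1" k] by (simp add: ac_simps)
    also have "k * (k - 1) + k = k ^ 2" using that by (cases k) (auto simp: power2_eq_square)
    then have "k * (k - 1) = k ^ 2 - k" by simp
    finally show "2 * k * ((k - 1) div 2) + (k - l) < n" using that by linarith
  qed (use that in auto)
  have "finite {(l, n). 1 \<le> l \<and> l < k \<and> 2 * k \<le> n \<and>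
      \<not> nonneg_if_polynomial (qbinom n k / qbinom n l :: 'a poly fract)}" for k
  proof (rule finite_subset)
    show "{(l, n). 1 \<le> l \<and> l < k \<and> 2 * k \<le> n \<and>
      \<not> nonneg_if_polynomial (qbinom n k / qbinom n l :: 'a poly fract)} \<subseteq> {..<k} \<times> {..<k ^ 2}"
      using 2 by (auto simp: not_le[symmetric])
  qed simp
  with 1 2 show ?thesis by blast
qed

end
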